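(* Consider, for every $m\in\mathbb{N}$, the model $y_m=A_mx_m^*+\varepsilon_m$ with $A_m\in\mathbb{R}^{m\times m}$ of rank $m$ and $\varepsilon_m\sim\mathcal{N}(0,\sigma^2I_m)$, where $\sigma^2>0$ does not depend on $m$, and suppose that the singular values of $A_m$ satisfy $1=\gamma_{1,m}\ge\gamma_{2,m}\ge\dots\ge\gamma_{m,m}>0$ for all $m$. Let $$c_m:=\Bigl(\sum_{i=1}^m\frac1{\gamma_{i,m}^2}\Bigr)^{-1},\qquad d_m:=c_m\sqrt{\sum_{i=1}^m\frac1{\gamma_{i,m}^4}}.$$ Then for any sequence of vectors $(x_m^* )_{m\in\mathbb{N}}$, $x_m^*\in\mathbb{R}^m$, such that $\max_{1\le i\le m}|x_{i,m}^*|$ is uniformly bounded in $m$, where $x_{i,m}^*$ are the coefficients of $x_m^*$ with respect to the right singular vectors of $A_m$, we have, as $m\to\infty$, $$\sup_{\alpha\in[0,\infty)}\bigl|c_m\,\mathrm{SURE}_m(\alpha,y_m)-\tilde{\mathcal{L}}_m(\alpha)\bigr|=O_{\mathbb{P}}(d_m).$$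
   Context: Tikhonov estimator: $\hat x_\alpha(y)=(A_m^{T}A_m+\alpha I)^{-1}A_m^{T}y$ for $\alpha\ge0$. Singular system: $A_m=U\Sigma V^{T}$, $\Sigma=\mathrm{diag}(\gamma_{1,m},\dots,\gamma_{m,m})$, $u_i,v_i$ the columns of the orthogonal matrices $U,V$; $y_i=\langle u_i,y\rangle$, $x_{i,m}^*=\langle v_i,x_m^*\rangle$. Loss: $\tilde{\mathcal{L}}_m(\alpha)=c_m\|\Pi(x_m^*-\hat x_\alpha(y_m))\|_2^2$, where $\Pi=A_m^+A_m$ is the orthogonal projector onto the range of $A_m^{T}$ (here the identity, as $A_m$ is invertible). Risk estimator: $$\mathrm{SURE}_m(\alpha,y)=\|A_m^{-1}y-\hat x_\alpha(y)\|_2^2-\sigma^2\,\mathrm{tr}\bigl((A_mA_m^{T})^{-1}\bigr)+2\sigma^2\,\mathrm{tr}\bigl((A_mA_m^{T})^{-1}A_m(A_m^{T}A_m+\alpha I)^{-1}A_m^{T}\bigr),$$ equivalently $$\mathrm{SURE}_m(\alpha,y)=\sum_{i=1}^m\Bigl(\frac1{\gamma_{i,m}}-\frac{\gamma_{i,m}}{\gamma_{i,m}^2+\alpha}\Bigr)^2y_i^2-\sigma^2\sum_{i=1}^m\frac1{\gamma_{i,m}^2}+2\sigma^2\sum_{i=1}^m\frac1{\gamma_{i,m}^2+\alpha}.$$ Stochastic order symbol: for random variables $Z_m$ and positive numbers $r_m$, $Z_m=O_{\mathbb{P}}(r_m)$ means $\lim_{T\to\infty}\limsup_{m\to\infty}\mathbb{P}(|Z_m|>Tr_m)=0$.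 *)

theory Defs
  imports
    "HOL-Probability.Probability"
    "Jordan_Normal_Form.DL_Rank"
    "Jordan_Normal_Form.Gauss_Jordan_Elimination"
begin

text \<open>
  The dimension is a running index, so vectors and matrices are the carrier-based
  types \<open>vec\<close> and \<open>mat\<close> of \<open>Jordan_Normal_Form\<close>; all component indices start at 0.
\<close>

unbundle no vec_syntax
no_notation inner (infix "\<bullet>" 70)

definition l2norm :: "real vec \<Rightarrow> real" where
  "l2norm v = sqrt (v \<bullet> v)"

definition mat_trace :: "real mat \<Rightarrow> real" where
  "mat_trace B = (\<Sum>i<dim_row B. B $$ (i, i))"

text \<open>Unspecified for singular arguments.\<close>
definition mat_inv :: "real mat \<Rightarrow> real mat" where
  "mat_inv B = the (mat_inverse B)"

text \<open>
  The Moore-Penrose inverse \<open>B\<^sup>+\<close>, given by the four Penrose equations.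
\<close>
definition is_pinv :: "real mat \<Rightarrow> real mat \<Rightarrow> bool" where
  "is_pinv B P \<longleftrightarrow> P \<in> carrier_mat (dim_col B) (dim_row B) \<and>
     B * P * B = B \<and> P * B * P = P \<and> (B * P)\<^sup>T = B * P \<and> (P * B)\<^sup>T = P * B"

definition pinv :: "real mat \<Rightarrow> real mat" where
  "pinv B = (THE P. is_pinv B P)"

text \<open>
  \<open>orthogonal_mat\<close> of \<open>Jordan_Normal_Form\<close> only asks for pairwise orthogonal nonzero
  columns, so orthonormality is written out here.
\<close>
definition singular_system :: "nat \<Rightarrow> real mat \<Rightarrow> real mat \<Rightarrow> (nat \<Rightarrow> real) \<Rightarrow> real mat \<Rightarrow> bool" where
  "singular_system n B U \<gamma> V \<longleftrightarrow>
     U \<in> carrier_mat n n \<and> U\<^sup>T * U = 1\<^sub>m n \<and> U * U\<^sup>T = 1\<^sub>m n \<and>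
     V \<in> carrier_mat n n \<and> V\<^sup>T * V = 1\<^sub>m n \<and> V * V\<^sup>T = 1\<^sub>m n \<and>
     B = U * mat_diag n \<gamma> * V\<^sup>T"

definition tikhonov :: "real mat \<Rightarrow> real \<Rightarrow> real vec \<Rightarrow> real vec" where
  "tikhonov B \<alpha> y = (mat_inv (B\<^sup>T * B + \<alpha> \<cdot>\<^sub>m 1\<^sub>m (dim_col B)) * B\<^sup>T) *\<^sub>v y"

definition SURE :: "real mat \<Rightarrow> real \<Rightarrow> real \<Rightarrow> real vec \<Rightarrow> real" where
  "SURE B \<sigma> \<alpha> y =
     (l2norm (mat_inv B *\<^sub>v y - tikhonov B \<alpha> y))\<^sup>2
     - \<sigma>\<^sup>2 * mat_trace (mat_inv (B * B\<^sup>T))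
     + 2 * \<sigma>\<^sup>2 * mat_trace (mat_inv (B * B\<^sup>T) * B
         * mat_inv (B\<^sup>T * B + \<alpha> \<cdot>\<^sub>m 1\<^sub>m (dim_col B)) * B\<^sup>T)"

definition proj_loss :: "real \<Rightarrow> real mat \<Rightarrow> real vec \<Rightarrow> real \<Rightarrow> real vec \<Rightarrow> real" where
  "proj_loss c B x \<alpha> y = c * (l2norm ((pinv B * B) *\<^sub>v (x - tikhonov B \<alpha> y)))\<^sup>2"

text \<open>
  \<open>e\<close> is distributed according to \<open>N(0, \<sigma>\<^sup>2 I\<^sub>n)\<close>. The last argument of
  \<open>normal_density\<close> is the standard deviation.
\<close>
definition gaussian_noise :: "'w measure \<Rightarrow> nat \<Rightarrow> real \<Rightarrow> ('w \<Rightarrow> real vec) \<Rightarrow> bool" where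
  "gaussian_noise M n \<sigma> e \<longleftrightarrow>
     (\<forall>\<omega>\<in>space M. e \<omega> \<in> carrier_vec n) \<and>
     prob_space.indep_vars M (\<lambda>_. borel) (\<lambda>i \<omega>. e \<omega> $ i) {..<n} \<and>
     (\<forall>i<n. distributed M lborel (\<lambda>\<omega>. e \<omega> $ i) (\<lambda>t. ennreal (normal_density 0 \<sigma> t)))"

text \<open>
  \<open>Z\<^sub>m = O\<^sub>P(r\<^sub>m)\<close> for random variables \<open>Z\<^sub>m\<close> and positive numbers \<open>r\<^sub>m\<close>, \<open>m \<ge> 1\<close>.
  Only the marginal laws matter, so each \<open>Z\<^sub>m\<close> may live on its own probability space.
  Values are extended reals so that possibly infinite suprema are admitted. Measurability
  is part of the notion because \<open>measure\<close> is 0 on non-measurable sets.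
\<close>
definition bigO_P :: "(nat \<Rightarrow> 'w measure) \<Rightarrow> (nat \<Rightarrow> 'w \<Rightarrow> ereal) \<Rightarrow> (nat \<Rightarrow> real) \<Rightarrow> bool" where
  "bigO_P M Z r \<longleftrightarrow>
     (\<forall>m\<ge>1. Z m \<in> borel_measurable (M m) \<and> 0 < r m) \<and>
     ((\<lambda>T::real. limsup (\<lambda>m. ereal (measure (M m)
         {\<omega> \<in> space (M m). \<bar>Z m \<omega>\<bar> > ereal (T * r m)}))) \<longlongrightarrow> 0) at_top"

end

theory Submission
  imports Defs
begin

text \<open>
  Let \<open>e\<^sub>i\<close> be the coordinates of the noise with respect to the left singular vectors. In singular
  coordinates, with \<open>t\<^sub>i = \<alpha> / (\<gamma>\<^sub>i\<^sup>2 + \<alpha>)\<close>, the difference between the risk estimator and the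
  unscaled loss is
  \<open>2 \<Sum>\<^sub>i t\<^sub>i w\<^sub>i - \<Sum>\<^sub>i (e\<^sub>i\<^sup>2 - \<sigma>\<^sup>2) / \<gamma>\<^sub>i\<^sup>2\<close>, where \<open>w\<^sub>i = (e\<^sub>i\<^sup>2 - \<sigma>\<^sup>2) / \<gamma>\<^sub>i\<^sup>2 + x\<^sub>i e\<^sub>i / \<gamma>\<^sub>i\<close> no
  longer depends on \<open>\<alpha>\<close>. The singular values decrease, so the weights \<open>t\<^sub>i\<close> increase within \<open>[0, 1]\<close>
  for every \<open>\<alpha>\<close>, and summation by parts bounds the first sum, uniformly in \<open>\<alpha>\<close>, by twice the largest
  partial sum of the \<open>w\<^sub>i\<close>. The \<open>e\<^sub>i\<close> are again independent and normal because the joint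
  characteristic function of Gaussian noise is rotation invariant. As \<open>\<gamma>\<^sub>i \<le> 1\<close>, the variance of
  \<open>w\<^sub>i\<close> is at most a constant times \<open>1 / \<gamma>\<^sub>i\<^sup>4\<close>, and the maximal inequality of Kolmogorov bounds the
  probability that the supremum exceeds \<open>T d\<^sub>m\<close> by a constant times \<open>1 / T\<^sup>2\<close>.
\<close>

section \<open>Singular value calculus\<close>

text \<open>\<open>mat_inverse\<close> returns an option, so the two-sided inverse is first used to
  rule out \<open>None\<close>; after that, inverses are unique.\<close>

lemma mat_inv_eqI:
  assumes "B \<in> carrier_mat n n" "C \<in> carrier_mat n n" "B * C = 1\<^sub>m n" "C * B = 1\<^sub>m n"
  shows "mat_inv B = C"
proof (cases "mat_inverse B")
  case None
  have "B \<in> Units (ring_mat TYPE(real) n ())"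
    using assms by (auto simp: Units_def ring_mat_def intro!: bexI[of _ C])
  then show ?thesis using mat_inverse(1)[OF assms(1) None, of "()"] by simp
next
  case (Some D)
  have D: "B * D = 1\<^sub>m n" "D * B = 1\<^sub>m n" "D \<in> carrier_mat n n"
    using mat_inverse(2)[OF assms(1) Some] by auto
  have "D = D * (B * C)" using D assms by simp
  also have "\<dots> = (D * B) * C" using D assms by (intro assoc_mult_mat[symmetric, of _ n n _ n _ n]) auto
  also have "\<dots> = C" using D assms by simp
  finally show ?thesis by (simp add: mat_inv_def Some)
qed

text \<open>\<open>pinv\<close> is a definite description, so uniqueness has to be shown. For
  invertible \<open>B\<close> the equation \<open>B * P * B = B\<close> forces \<open>P = C\<close>
  after multiplication by \<open>C\<close> on both sides.\<close>

lemma pinv_mult_self: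
  assumes B: "B \<in> carrier_mat n n" and C: "C \<in> carrier_mat n n"
    and BC: "B * C = 1\<^sub>m n" and CB: "C * B = 1\<^sub>m n"
  shows "pinv B * B = 1\<^sub>m n"
proof -
  have "pinv B = C" unfolding pinv_def
  proof (rule the_equality)
    show "is_pinv B C" using assms by (auto simp: is_pinv_def)
  next
    fix P assume "is_pinv B P"
    then have P: "P \<in> carrier_mat n n" and BPB: "B * P * B = B" using B by (auto simp: is_pinv_def)
    have "P = (C * B) * P * (B * C)" using P BC CB by simp
    also have "\<dots> = C * (B * P * B) * C"
      using P B C by (simp add: assoc_mult_mat[of _ n n _ n _ n] mult_carrier_mat[of _ n n _ n])
    also have "\<dots> = C" using BPB C CB by simp
    finally show "P = C" .
  qed
  then show ?thesis by (simp add: CB)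
qed

text \<open>The matrices in the estimators are all diagonal with respect to the singular bases. In
  this form products, shifts by multiples of the identity, inverses and traces reduce to pointwise
  operations on \<open>f\<close>.\<close>

definition sandwich :: "nat \<Rightarrow> real mat \<Rightarrow> (nat \<Rightarrow> real) \<Rightarrow> real mat \<Rightarrow> real mat" where
  "sandwich n U f V = U * mat_diag n f * V\<^sup>T"

definition orthonormal_mat :: "nat \<Rightarrow> real mat \<Rightarrow> bool" where
  "orthonormal_mat n U \<longleftrightarrow> U \<in> carrier_mat n n \<and> U\<^sup>T * U = 1\<^sub>m n \<and> U * U\<^sup>T = 1\<^sub>m n"

lemma sandwich_carrier [simp]:
  "U \<in> carrier_mat n n \<Longrightarrow> V \<in> carrier_mat n n \<Longrightarrow> sandwich n U f V \<in> carrier_mat n n"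
  by (auto simp: sandwich_def)

lemma sandwich_dim [simp]:
  "U \<in> carrier_mat n n \<Longrightarrow> dim_row (sandwich n U f V) = n"
  "V \<in> carrier_mat n n \<Longrightarrow> dim_col (sandwich n U f V) = n"
  by (auto simp: sandwich_def)

text \<open>The middle factor \<open>V\<^sup>T * V\<close> cancels, and diagonal matrices multiply
  entrywise.\<close>

lemma sandwich_mult:
  assumes "U \<in> carrier_mat n n" "orthonormal_mat n V" "W \<in> carrier_mat n n"
  shows "sandwich n U f V * sandwich n V g W = sandwich n U (\<lambda>i. f i * g i) W"
proof -
  have V: "V \<in> carrier_mat n n" "V\<^sup>T * V = 1\<^sub>m n" using assms by (auto simp: orthonormal_mat_def)
  note [simp] = assoc_mult_mat[of _ n n _ n _ n] mult_carrier_mat[of _ n n _ n]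
  have "sandwich n U f V * sandwich n V g W
      = U * (mat_diag n f * ((V\<^sup>T * V) * (mat_diag n g * W\<^sup>T)))"
    unfolding sandwich_def using V(1) assms by simp
  also have "\<dots> = U * ((mat_diag n f * mat_diag n g) * W\<^sup>T)"
    unfolding V(2) using V(1) assms by (simp del: mat_diag_diag add: left_mult_one_mat[of _ n n])
  also have "\<dots> = sandwich n U (\<lambda>i. f i * g i) W"
    unfolding sandwich_def using assms by simp
  finally show ?thesis .
qed

lemma transpose_mat_diag: "(mat_diag n f)\<^sup>T = mat_diag n f"
  by (auto simp: mat_diag_def)

lemma sandwich_transpose:
  assumes "U \<in> carrier_mat n n" "V \<in> carrier_mat n n"
  shows "(sandwich n U f V)\<^sup>T = sandwich n V f U"
  unfolding sandwich_def using assms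
  by (subst transpose_mult[of _ n n _ n], simp, simp, subst transpose_mult[of _ n n _ n])
     (auto simp: transpose_mat_diag assoc_mult_mat[of _ n n _ n _ n] mult_carrier_mat[of _ n n _ n])

lemma sandwich_index:
  assumes "U \<in> carrier_mat n n" "V \<in> carrier_mat n n" "i < n" "j < n"
  shows "sandwich n U f V $$ (i, j) = (\<Sum>k<n. U $$ (i, k) * f k * V $$ (j, k))"
  unfolding sandwich_def using assms
  by (subst mat_diag_mult_right[of _ n]) (auto simp: scalar_prod_def lessThan_atLeast0 intro!: sum.cong)

lemma sandwich_one:
  assumes "orthonormal_mat n U"
  shows "sandwich n U (\<lambda>_. 1) U = 1\<^sub>m n"
  using assms by (auto simp: sandwich_def orthonormal_mat_def)

lemma sandwich_cong:
  "(\<And>i. i < n \<Longrightarrow> f i = g i) \<Longrightarrow> sandwich n U f V = sandwich n U g V"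
  unfolding sandwich_def mat_diag_def by (intro arg_cong2[of _ _ _ _ "(*)"] refl eq_matI) auto

lemma sandwich_add_smult_one:
  assumes U: "orthonormal_mat n U"
  shows "sandwich n U f U + a \<cdot>\<^sub>m 1\<^sub>m n = sandwich n U (\<lambda>i. f i + a) U"
proof -
  have Uc: "U \<in> carrier_mat n n" using U by (auto simp: orthonormal_mat_def)
  have "a \<cdot>\<^sub>m 1\<^sub>m n = a \<cdot>\<^sub>m sandwich n U (\<lambda>_. 1) U" by (simp add: sandwich_one[OF U])
  also have "sandwich n U f U + \<dots> = sandwich n U (\<lambda>i. f i + a) U"
    by (rule eq_matI) (use Uc in \<open>auto simp: sandwich_index[OF Uc Uc] sum_distrib_left
        sum.distrib distrib_left distrib_right mult_ac\<close>)
  finally show ?thesis .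
qed

lemma
  assumes U: "orthonormal_mat n U" and V: "orthonormal_mat n V"
    and f: "\<And>i. i < n \<Longrightarrow> f i \<noteq> 0"
  shows mat_inv_sandwich: "mat_inv (sandwich n U f V) = sandwich n V (\<lambda>i. 1 / f i) U"
    and pinv_mult_sandwich: "pinv (sandwich n U f V) * sandwich n U f V = 1\<^sub>m n"
proof -
  have Uc: "U \<in> carrier_mat n n" "V \<in> carrier_mat n n" using U V by (auto simp: orthonormal_mat_def)
  have 1: "sandwich n U f V * sandwich n V (\<lambda>i. 1 / f i) U = 1\<^sub>m n"
    using Uc f by (simp add: sandwich_mult[OF _ V] sandwich_one[OF U, symmetric] cong: sandwich_cong)
  have 2: "sandwich n V (\<lambda>i. 1 / f i) U * sandwich n U f V = 1\<^sub>m n"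
    using Uc f by (simp add: sandwich_mult[OF _ U] sandwich_one[OF V, symmetric] cong: sandwich_cong)
  show "mat_inv (sandwich n U f V) = sandwich n V (\<lambda>i. 1 / f i) U"
    using Uc 1 2 by (intro mat_inv_eqI[of _ n]) auto
  show "pinv (sandwich n U f V) * sandwich n U f V = 1\<^sub>m n"
    by (rule pinv_mult_self[OF _ _ 1 2]) (use Uc in auto)
qed

text \<open>After exchanging the sums, each \<open>f k\<close> is multiplied by the squared norm of
  column \<open>k\<close> of \<open>U\<close>, which is 1.\<close>

lemma mat_trace_sandwich:
  assumes U: "orthonormal_mat n U"
  shows "mat_trace (sandwich n U f U) = (\<Sum>i<n. f i)"
proof -
  have Uc: "U \<in> carrier_mat n n" and UU: "U\<^sup>T * U = 1\<^sub>m n" using U by (auto simp: orthonormal_mat_def)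
  have col: "(\<Sum>i<n. U $$ (i, k) * U $$ (i, k)) = 1" if "k < n" for k
  proof -
    have "(U\<^sup>T * U) $$ (k, k) = (\<Sum>i<n. U $$ (i, k) * U $$ (i, k))"
      using Uc that by (auto simp: scalar_prod_def lessThan_atLeast0)
    then show ?thesis using UU that by simp
  qed
  have "mat_trace (sandwich n U f U) = (\<Sum>i<n. \<Sum>k<n. U $$ (i, k) * f k * U $$ (i, k))"
    by (simp add: mat_trace_def Uc sandwich_index[OF Uc Uc])
  also have "\<dots> = (\<Sum>k<n. f k * (\<Sum>i<n. U $$ (i, k) * U $$ (i, k)))"
    by (subst sum.swap) (simp add: sum_distrib_left mult_ac)
  also have "\<dots> = (\<Sum>i<n. f i)" using col by simp
  finally show ?thesis .
qed

lemma l2norm_sq: "v \<in> carrier_vec n \<Longrightarrow> (l2norm v)\<^sup>2 = (\<Sum>i<n. (v $ i)\<^sup>2)"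
  by (auto simp: l2norm_def scalar_prod_def power2_eq_square lessThan_atLeast0 abs_of_nonneg sum_nonneg)

lemma orthonormal_mat_transpose: "orthonormal_mat n U \<Longrightarrow> orthonormal_mat n U\<^sup>T"
  by (auto simp: orthonormal_mat_def)

lemma l2norm_orthonormal_mult:
  assumes U: "orthonormal_mat n U" and v: "v \<in> carrier_vec n"
  shows "l2norm (U *\<^sub>v v) = l2norm v"
proof -
  have Uc: "U \<in> carrier_mat n n" and UU: "U\<^sup>T * U = 1\<^sub>m n" using U by (auto simp: orthonormal_mat_def)
  have "(U *\<^sub>v v) \<bullet> (U *\<^sub>v v) = (U\<^sup>T *\<^sub>v (U *\<^sub>v v)) \<bullet> v"
    using transpose_vec_mult_scalar[of U n n v "U *\<^sub>v v"] Uc v by simp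
  also have "U\<^sup>T *\<^sub>v (U *\<^sub>v v) = v"
    using Uc v UU by (subst assoc_mult_mat_vec[symmetric, of _ n n _ n]) auto
  finally show ?thesis by (simp add: l2norm_def)
qed

text \<open>Multiplying by \<open>U\<^sup>T\<close> cancels the left factor of the sandwich, and the
  entries of \<open>U\<^sup>T *\<^sub>v w\<close> are the coefficients
  \<open>col U i \<bullet> w\<close>.\<close>

lemma sandwich_mult_vec_coord:
  assumes U: "orthonormal_mat n U" and V: "V \<in> carrier_mat n n" and v: "v \<in> carrier_vec n" and "i < n"
  shows "col U i \<bullet> (sandwich n U f V *\<^sub>v v) = f i * (col V i \<bullet> v)"
proof -
  have Uc: "U \<in> carrier_mat n n" and UU: "U\<^sup>T * U = 1\<^sub>m n" using U by (auto simp: orthonormal_mat_def)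
  have "U\<^sup>T *\<^sub>v (sandwich n U f V *\<^sub>v v) = (U\<^sup>T * sandwich n U f V) *\<^sub>v v"
    by (rule assoc_mult_mat_vec[symmetric, of _ n n _ n]) (use Uc V v in auto)
  also have "U\<^sup>T * sandwich n U f V = (U\<^sup>T * U) * (mat_diag n f * V\<^sup>T)"
    unfolding sandwich_def using Uc V by (simp add: assoc_mult_mat[of _ n n _ n _ n] mult_carrier_mat[of _ n n _ n])
  also have "\<dots> = mat_diag n f * V\<^sup>T"
    unfolding UU using V by (intro left_mult_one_mat[of _ n n] mult_carrier_mat[of _ n n]) auto
  also have "(mat_diag n f * V\<^sup>T) *\<^sub>v v = mat_diag n f *\<^sub>v (V\<^sup>T *\<^sub>v v)"
    by (rule assoc_mult_mat_vec[of _ n n _ n]) (use V v in auto)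
  finally have eq: "U\<^sup>T *\<^sub>v (sandwich n U f V *\<^sub>v v) = mat_diag n f *\<^sub>v (V\<^sup>T *\<^sub>v v)" .
  have "col U i \<bullet> (sandwich n U f V *\<^sub>v v) = (mat_diag n f *\<^sub>v (V\<^sup>T *\<^sub>v v)) $ i"
    unfolding eq[symmetric] using Uc \<open>i < n\<close> by simp
  also have "\<dots> = (\<Sum>j<n. (if i = j then f j else 0) * (col V j \<bullet> v))"
    using \<open>i < n\<close> V by (auto simp: mat_diag_def scalar_prod_def[of "Matrix.vec _ _"] lessThan_atLeast0 intro!: sum.cong)
  also have "\<dots> = f i * (col V i \<bullet> v)"
    using \<open>i < n\<close> by (simp add: if_distrib[of "\<lambda>x. x * _"] sum.delta cong: if_cong)
  finally show ?thesis .
qed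

text \<open>Parseval's identity: \<open>U\<^sup>T\<close> preserves the norm and lists the
  coefficients with respect to the columns of \<open>U\<close>.\<close>

lemma l2norm_sq_coords:
  assumes U: "orthonormal_mat n U" and v: "v \<in> carrier_vec n"
  shows "(l2norm v)\<^sup>2 = (\<Sum>i<n. (col U i \<bullet> v)\<^sup>2)"
proof -
  have Uc: "U \<in> carrier_mat n n" using U by (auto simp: orthonormal_mat_def)
  have "(l2norm v)\<^sup>2 = (l2norm (U\<^sup>T *\<^sub>v v))\<^sup>2"
    using l2norm_orthonormal_mult[OF orthonormal_mat_transpose[OF U] v] by simp
  also have "\<dots> = (\<Sum>i<n. (col U i \<bullet> v)\<^sup>2)"
    using Uc v by (subst l2norm_sq[of _ n]) auto
  finally show ?thesis .
qed

section \<open>Risk estimator and loss in singular coordinates\<close>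

locale singular_decomposition =
  fixes n :: nat and B U V :: "real mat" and g :: "nat \<Rightarrow> real"
  assumes sys: "singular_system n B U g V" and gpos: "\<And>i. i < n \<Longrightarrow> 0 < g i"
begin

lemma B_eq: "B = sandwich n U g V"
  and U_orthonormal: "orthonormal_mat n U" and V_orthonormal: "orthonormal_mat n V"
  and U_carrier: "U \<in> carrier_mat n n" and V_carrier: "V \<in> carrier_mat n n" and B_carrier: "B \<in> carrier_mat n n"
  using sys by (auto simp: singular_system_def sandwich_def orthonormal_mat_def)

text \<open>The regularised Gram matrix has the spectrum \<open>(g i)\<^sup>2 + \<alpha>\<close>,
  which is positive even at \<open>\<alpha> = 0\<close> since the singular values are.\<close>

lemma gram_add_inv:
  assumes "0 \<le> \<alpha>"
  shows "mat_inv (B\<^sup>T * B + \<alpha> \<cdot>\<^sub>m 1\<^sub>m (dim_col B)) * B\<^sup>T = sandwich n V (\<lambda>i. g i / ((g i)\<^sup>2 + \<alpha>)) U"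
proof -
  have nz: "g i * g i + \<alpha> \<noteq> 0" if "i < n" for i
    using gpos[OF that] assms by (smt (verit) mult_pos_pos)
  have "B\<^sup>T * B + \<alpha> \<cdot>\<^sub>m 1\<^sub>m (dim_col B) = sandwich n V (\<lambda>i. g i * g i + \<alpha>) V"
    using B_carrier U_carrier V_carrier by
      (simp add: B_eq sandwich_transpose sandwich_mult[OF _ U_orthonormal]
        sandwich_add_smult_one[OF V_orthonormal])
  then show ?thesis
    using U_carrier V_carrier nz by (simp add: B_eq sandwich_transpose
        mat_inv_sandwich[OF V_orthonormal V_orthonormal] sandwich_mult[OF _ V_orthonormal]
        power2_eq_square)
qed

lemma tikhonov_eq:
  "0 \<le> \<alpha> \<Longrightarrow> tikhonov B \<alpha> y = sandwich n V (\<lambda>i. g i / ((g i)\<^sup>2 + \<alpha>)) U *\<^sub>v y"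
  by (simp add: tikhonov_def gram_add_inv)

lemma SURE_eq:
  assumes \<alpha>: "0 \<le> \<alpha>" and y: "y \<in> carrier_vec n"
  shows "SURE B \<sigma> \<alpha> y = (\<Sum>i<n. (1 / g i - g i / ((g i)\<^sup>2 + \<alpha>))\<^sup>2 * (col U i \<bullet> y)\<^sup>2)
     - \<sigma>\<^sup>2 * (\<Sum>i<n. 1 / (g i)\<^sup>2) + 2 * \<sigma>\<^sup>2 * (\<Sum>i<n. 1 / ((g i)\<^sup>2 + \<alpha>))"
proof -
  have nz: "g i \<noteq> 0" if "i < n" for i using gpos[OF that] by simp
  have Binv: "mat_inv B = sandwich n V (\<lambda>i. 1 / g i) U"
    unfolding B_eq using nz by (rule mat_inv_sandwich[OF U_orthonormal V_orthonormal])
  have BBinv: "mat_inv (B * B\<^sup>T) = sandwich n U (\<lambda>i. 1 / (g i)\<^sup>2) U"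
    using U_carrier V_carrier nz by
      (simp add: B_eq sandwich_transpose sandwich_mult[OF _ V_orthonormal]
        mat_inv_sandwich[OF U_orthonormal U_orthonormal] power2_eq_square)
  \<comment> \<open>The product in \<open>SURE\<close> is grouped to the left; regrouping exposes
    the Tikhonov matrix computed in \<open>gram_add_inv\<close>.\<close>
  have "mat_inv (B * B\<^sup>T) * B * mat_inv (B\<^sup>T * B + \<alpha> \<cdot>\<^sub>m 1\<^sub>m (dim_col B)) * B\<^sup>T
      = mat_inv (B * B\<^sup>T) * B * (mat_inv (B\<^sup>T * B + \<alpha> \<cdot>\<^sub>m 1\<^sub>m (dim_col B)) * B\<^sup>T)"
  proof (rule assoc_mult_mat[of _ n n _ n _ n])
    have "g i * g i + \<alpha> \<noteq> 0" if "i < n" for i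
      using gpos[OF that] \<alpha> by (smt (verit) mult_pos_pos)
    then show "mat_inv (B\<^sup>T * B + \<alpha> \<cdot>\<^sub>m 1\<^sub>m (dim_col B)) \<in> carrier_mat n n"
      using B_carrier U_carrier V_carrier by
      (simp add: B_eq sandwich_transpose sandwich_mult[OF _ U_orthonormal]
        sandwich_add_smult_one[OF V_orthonormal]
        mat_inv_sandwich[OF V_orthonormal V_orthonormal])
  qed (use B_carrier U_carrier in \<open>auto simp: BBinv\<close>)
  also have "\<dots> = sandwich n U (\<lambda>i. 1 / (g i)\<^sup>2) U * sandwich n U g V
      * sandwich n V (\<lambda>i. g i / ((g i)\<^sup>2 + \<alpha>)) U"
    by (simp only: gram_add_inv[OF \<alpha>] BBinv B_eq[symmetric])
  also have "\<dots> = sandwich n U (\<lambda>i. 1 / ((g i)\<^sup>2 + \<alpha>)) U"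
    using U_carrier V_carrier nz by (simp add: sandwich_mult[OF _ U_orthonormal] sandwich_mult[OF _ V_orthonormal]
        power2_eq_square cong: sandwich_cong)
  finally have 3: "mat_trace (mat_inv (B * B\<^sup>T) * B * mat_inv (B\<^sup>T * B + \<alpha> \<cdot>\<^sub>m 1\<^sub>m (dim_col B)) * B\<^sup>T)
      = (\<Sum>i<n. 1 / ((g i)\<^sup>2 + \<alpha>))"
    by (simp add: mat_trace_sandwich[OF U_orthonormal])
  have vc: "sandwich n V f U *\<^sub>v y \<in> carrier_vec n" for f
    using sandwich_carrier[OF V_carrier U_carrier, of f] y by auto
  have "(l2norm (mat_inv B *\<^sub>v y - tikhonov B \<alpha> y))\<^sup>2
      = (\<Sum>i<n. ((1 / g i - g i / ((g i)\<^sup>2 + \<alpha>)) * (col U i \<bullet> y))\<^sup>2)"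
    unfolding Binv tikhonov_eq[OF \<alpha>] using vc V_carrier
    by (subst l2norm_sq_coords[OF V_orthonormal])
       (auto simp: scalar_prod_minus_distrib[of _ n] sandwich_mult_vec_coord[OF V_orthonormal U_carrier y] left_diff_distrib)
  then show ?thesis
    unfolding SURE_def 3 unfolding BBinv by (simp add: mat_trace_sandwich[OF U_orthonormal] power_mult_distrib)
qed

lemma proj_loss_eq:
  assumes \<alpha>: "0 \<le> \<alpha>" and y: "y \<in> carrier_vec n" and x: "x \<in> carrier_vec n"
  shows "proj_loss c B x \<alpha> y = c * (\<Sum>i<n. (col V i \<bullet> x - g i / ((g i)\<^sup>2 + \<alpha>) * (col U i \<bullet> y))\<^sup>2)"
proof -
  have nz: "g i \<noteq> 0" if "i < n" for i using gpos[OF that] by simp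
  have vc: "sandwich n V f U *\<^sub>v y \<in> carrier_vec n" for f
    using sandwich_carrier[OF V_carrier U_carrier, of f] y by auto
  have "pinv B * B = 1\<^sub>m n" unfolding B_eq using nz by (rule pinv_mult_sandwich[OF U_orthonormal V_orthonormal])
  then show ?thesis
    unfolding proj_loss_def tikhonov_eq[OF \<alpha>] using vc V_carrier x
    by (subst l2norm_sq_coords[OF V_orthonormal])
       (auto simp: scalar_prod_minus_distrib[of _ n] sandwich_mult_vec_coord[OF V_orthonormal U_carrier y])
qed

text \<open>Works coordinate by coordinate: the terms quadratic in the signal coefficient cancel,
  and the rest is affine in the weight \<open>\<alpha> / ((g i)\<^sup>2 + \<alpha>)\<close>. Only
  this weight carries \<alpha>, which is what permits a bound uniform in \<alpha>.\<close>

lemma SURE_minus_proj_loss: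
  assumes \<alpha>: "0 \<le> \<alpha>" and x: "x \<in> carrier_vec n" and e: "e \<in> carrier_vec n"
  shows "c * SURE B \<sigma> \<alpha> (B *\<^sub>v x + e) - proj_loss c B x \<alpha> (B *\<^sub>v x + e) =
    c * (2 * (\<Sum>i<n. \<alpha> / ((g i)\<^sup>2 + \<alpha>) *
            (((col U i \<bullet> e)\<^sup>2 - \<sigma>\<^sup>2) / (g i)\<^sup>2 + (col V i \<bullet> x) * (col U i \<bullet> e) / g i))
         - (\<Sum>i<n. ((col U i \<bullet> e)\<^sup>2 - \<sigma>\<^sup>2) / (g i)\<^sup>2))"
proof -
  have y: "B *\<^sub>v x + e \<in> carrier_vec n" using B_carrier x e by (intro add_carrier_vec mult_mat_vec_carrier)
  have coord: "col U i \<bullet> (B *\<^sub>v x + e) = g i * (col V i \<bullet> x) + col U i \<bullet> e" if "i < n" for i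
    using that x e B_carrier U_carrier sandwich_mult_vec_coord[OF U_orthonormal V_carrier x that, of g]
    by (subst scalar_prod_add_distrib[of _ n]) (auto simp: B_eq)
  \<comment> \<open>\<open>G\<close>, \<open>X\<close>, \<open>E\<close> and \<open>s\<close> stand
    for a singular value, a signal coefficient, a noise coefficient and the noise variance.\<close>
  have key: "(1 / G - G / (G\<^sup>2 + \<alpha>))\<^sup>2 * (G * X + E)\<^sup>2 - s / G\<^sup>2 + 2 * s / (G\<^sup>2 + \<alpha>)
      - (X - G / (G\<^sup>2 + \<alpha>) * (G * X + E))\<^sup>2
     = 2 * (\<alpha> / (G\<^sup>2 + \<alpha>) * ((E\<^sup>2 - s) / G\<^sup>2 + X * E / G)) - (E\<^sup>2 - s) / G\<^sup>2"
    if "0 < G" for G X E s :: real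
  proof -
    define D where "D = G\<^sup>2 + \<alpha>"
    have D: "D > 0" using that \<alpha> by (simp add: D_def add_pos_nonneg)
    \<comment> \<open>Trading \<alpha> for the positive denominator \<open>D\<close> leaves a
      rational identity whose denominators are powers of \<open>G\<close> and
      \<open>D\<close>.\<close>
    have \<alpha>': "\<alpha> = D - G\<^sup>2" by (simp add: D_def)
    show ?thesis unfolding D_def[symmetric] unfolding \<alpha>' using D that
      by (simp add: field_simps power2_eq_square) 
  qed
  have "SURE B \<sigma> \<alpha> (B *\<^sub>v x + e)
      - (\<Sum>i<n. (col V i \<bullet> x - g i / ((g i)\<^sup>2 + \<alpha>) * (col U i \<bullet> (B *\<^sub>v x + e)))\<^sup>2)
    = (\<Sum>i<n. (1 / g i - g i / ((g i)\<^sup>2 + \<alpha>))\<^sup>2 * (g i * (col V i \<bullet> x) + col U i \<bullet> e)\<^sup>2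
        - \<sigma>\<^sup>2 / (g i)\<^sup>2 + 2 * \<sigma>\<^sup>2 / ((g i)\<^sup>2 + \<alpha>)
        - (col V i \<bullet> x - g i / ((g i)\<^sup>2 + \<alpha>) * (g i * (col V i \<bullet> x) + col U i \<bullet> e))\<^sup>2)"
    unfolding SURE_eq[OF \<alpha> y]
    by (simp add: coord sum_subtractf sum.distrib sum_distrib_left)
  also have "\<dots> = (\<Sum>i<n. 2 * (\<alpha> / ((g i)\<^sup>2 + \<alpha>) *
            (((col U i \<bullet> e)\<^sup>2 - \<sigma>\<^sup>2) / (g i)\<^sup>2 + (col V i \<bullet> x) * (col U i \<bullet> e) / g i))
         - ((col U i \<bullet> e)\<^sup>2 - \<sigma>\<^sup>2) / (g i)\<^sup>2)"
    by (intro sum.cong refl key gpos) auto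
  finally show ?thesis
    unfolding proj_loss_eq[OF \<alpha> y x] right_diff_distrib[symmetric]
    by (simp add: sum_subtractf sum_distrib_left)
qed

end

section \<open>Independence from the joint characteristic function\<close>

text \<open>Under the probability measure with density \<open>W / expectation W\<close>, the
  variable \<open>X\<close> has characteristic function \<open>char \<nu>\<close>, so Levy's
  uniqueness theorem identifies its law with \<nu>. A weight of mean zero cannot be normalised, but
  then both sides vanish.\<close>

lemma (in prob_space) weighted_law_unique:
  fixes X W :: "'a \<Rightarrow> real" and \<nu> :: "real measure"
  assumes [measurable]: "X \<in> borel_measurable M" and W: "integrable M W" "\<And>\<omega>. 0 \<le> W \<omega>"
    and \<nu>: "real_distribution \<nu>"
    and char: "\<And>s. (CLINT \<omega>|M. of_real (W \<omega>) * iexp (s * X \<omega>)) = char \<nu> s * of_real (expectation W)"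
    and B: "B \<in> sets borel"
  shows "expectation (\<lambda>\<omega>. W \<omega> * indicator B (X \<omega>)) = measure \<nu> B * expectation W"
proof (cases "expectation W = 0")
  case True
  then have "AE \<omega> in M. W \<omega> = 0"
    using W by (simp add: integral_nonneg_eq_0_iff_AE)
  then have "AE \<omega> in M. W \<omega> * indicator B (X \<omega>) = 0" by eventually_elim simp
  then have "expectation (\<lambda>\<omega>. W \<omega> * indicator B (X \<omega>)) = 0"
    by (rule integral_eq_zero_AE)
  then show ?thesis using True by simp
next
  case False
  define w where "w = expectation W"
  have w: "0 < w" using False W unfolding w_def
    by (metis Bochner_Integration.integral_nonneg less_eq_real_def)
  have [measurable]: "W \<in> borel_measurable M" using W by auto
  define N where "N = density M (\<lambda>\<omega>. ennreal (W \<omega> / w))"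
  have "emeasure N (space N) = (\<integral>\<^sup>+\<omega>. ennreal (W \<omega> / w) \<partial>M)"
    by (simp add: N_def emeasure_density cong: nn_integral_cong)
  also have "\<dots> = ennreal (\<integral>\<omega>. W \<omega> / w \<partial>M)"
    using W w by (intro nn_integral_eq_integral) auto
  also have "\<dots> = 1" using w by (simp add: w_def)
  finally interpret N: prob_space N by (rule prob_spaceI)
  have [measurable]: "X \<in> borel_measurable N" by (simp add: N_def)
  have dist: "real_distribution (distr N borel X)"
    by (auto simp: real_distribution_def real_distribution_axioms_def intro!: N.prob_space_distr)
  have "char (distr N borel X) s = char \<nu> s" for s
  proof -
    have "char (distr N borel X) s = (CLINT \<omega>|N. iexp (s * X \<omega>))"
      by (simp add: char_def integral_distr)
    also have "\<dots> = (CLINT \<omega>|M. (W \<omega> / w) *\<^sub>R iexp (s * X \<omega>))"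
      unfolding N_def using W w by (subst integral_density) auto
    also have "\<dots> = (CLINT \<omega>|M. (of_real (W \<omega>) * iexp (s * X \<omega>)) / of_real w)"
      by (intro Bochner_Integration.integral_cong) (auto simp: scaleR_conv_of_real)
    also have "\<dots> = char \<nu> s" using w char[of s] by (simp add: w_def)
    finally show ?thesis .
  qed
  then have eq: "distr N borel X = \<nu>"
    by (intro Levy_uniqueness dist \<nu>) auto
  have "measure \<nu> B = measure N (X -` B \<inter> space N)"
    unfolding eq[symmetric] using B by (simp add: measure_distr)
  also have "\<dots> = (\<integral>\<omega>. indicator (X -` B \<inter> space N) \<omega> \<partial>N)" by simp
  also have "\<dots> = (\<integral>\<omega>. indicator B (X \<omega>) \<partial>N)"
    by (intro Bochner_Integration.integral_cong) (auto simp: indicator_def)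
  also have "\<dots> = (\<integral>\<omega>. (W \<omega> / w) *\<^sub>R indicator B (X \<omega>) \<partial>M)"
    unfolding N_def using W w B by (subst integral_density) auto
  also have "\<dots> = expectation (\<lambda>\<omega>. W \<omega> * indicator B (X \<omega>)) / w" by simp
  finally show ?thesis using w by (simp add: w_def)
qed

text \<open>
  Reduces to nonnegative weights: \<open>P\<close>, \<open>P + Re Z\<close> and \<open>P + Im Z\<close> are nonnegative and complex linear combinations
  of \<open>P\<close>, \<open>Z\<close> and the conjugate of \<open>Z\<close>.
\<close>
lemma (in prob_space) complex_weighted_law_unique:
  fixes X P :: "'a \<Rightarrow> real" and Z :: "'a \<Rightarrow> complex" and \<nu> :: "real measure"
  assumes X[measurable]: "X \<in> borel_measurable M" and P: "integrable M P"
    and Z: "Z \<in> borel_measurable M" "\<And>\<omega>. cmod (Z \<omega>) \<le> P \<omega>"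
    and \<nu>: "real_distribution \<nu>"
    and charP: "\<And>s. (CLINT \<omega>|M. of_real (P \<omega>) * iexp (s * X \<omega>)) = char \<nu> s * (CLINT \<omega>|M. of_real (P \<omega>))"
    and charZ: "\<And>s. (CLINT \<omega>|M. Z \<omega> * iexp (s * X \<omega>)) = char \<nu> s * (CLINT \<omega>|M. Z \<omega>)"
    and charZ': "\<And>s. (CLINT \<omega>|M. cnj (Z \<omega>) * iexp (s * X \<omega>)) = char \<nu> s * (CLINT \<omega>|M. cnj (Z \<omega>))"
    and B: "B \<in> sets borel"
  shows "(CLINT \<omega>|M. Z \<omega> * indicator B (X \<omega>)) = of_real (measure \<nu> B) * (CLINT \<omega>|M. Z \<omega>)"
proof -
  have P0: "0 \<le> P \<omega>" for \<omega> using Z(2)[of \<omega>] norm_ge_zero order_trans by blast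
  have ReP: "\<bar>Re (Z \<omega>)\<bar> \<le> P \<omega>" and ImP: "\<bar>Im (Z \<omega>)\<bar> \<le> P \<omega>" for \<omega>
    using Z(2)[of \<omega>] abs_Re_le_cmod[of "Z \<omega>"] abs_Im_le_cmod[of "Z \<omega>"] by linarith+
  have [measurable]: "Z \<in> borel_measurable M" by fact
  have [measurable]: "P \<in> borel_measurable M" using P by auto
  have intZ: "integrable M Z"
    by (rule Bochner_Integration.integrable_bound[OF P]) (use Z(2) P0 in auto)
  have mult: "integrable M (\<lambda>\<omega>. F \<omega> * iexp (s * X \<omega>))" if "integrable M F" for F :: "'a \<Rightarrow> complex" and s
    using that borel_measurable_integrable[OF that]
    by (elim Bochner_Integration.integrable_bound) (auto simp: norm_mult)
  have indr: "integrable M (\<lambda>\<omega>. F \<omega> * indicator B (X \<omega>))" if "integrable M F" for F :: "'a \<Rightarrow> real"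
    using that borel_measurable_integrable[OF that]
    by (elim Bochner_Integration.integrable_bound) (use B in \<open>auto simp: indicator_def\<close>)
  have indc: "integrable M (\<lambda>\<omega>. F \<omega> * indicator B (X \<omega>))" if "integrable M F" for F :: "'a \<Rightarrow> complex"
    using that borel_measurable_integrable[OF that]
    by (elim Bochner_Integration.integrable_bound) (use B in \<open>auto simp: indicator_def\<close>)
  \<comment> \<open>For a nonnegative weight that is \<open>P\<close> plus a complex combination of
    \<open>Z\<close> and its conjugate, the hypothesis of \<open>weighted_law_unique\<close> follows
    from the three given identities by linearity.\<close>
  have comb: "expectation (\<lambda>\<omega>. V \<omega> * indicator B (X \<omega>)) = measure \<nu> B * expectation V"
    if V: "\<And>\<omega>. complex_of_real (V \<omega>) = of_real (P \<omega>) + a * Z \<omega> + b * cnj (Z \<omega>)" "\<And>\<omega>. 0 \<le> V \<omega>"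
    and VM: "V \<in> borel_measurable M"
    for V :: "'a \<Rightarrow> real" and a b :: complex
  proof -
    have intV: "integrable M V"
    proof -
      have "integrable M (\<lambda>\<omega>. of_real (P \<omega>) + a * Z \<omega> + b * cnj (Z \<omega>))" using P intZ by auto
      then have "integrable M (\<lambda>\<omega>. complex_of_real (V \<omega>))" by (simp add: V)
      then show ?thesis using complex_of_real_integrable_eq by blast
    qed
    show ?thesis
    proof (rule weighted_law_unique[OF X intV V(2) \<nu> _ B])
      fix s
      define E where "E \<omega> = iexp (s * X \<omega>)" for \<omega>
      note E = mult[of _ s, folded E_def] charP[of s, folded E_def] charZ[of s, folded E_def]
        charZ'[of s, folded E_def]
      have "(CLINT \<omega>|M. of_real (V \<omega>) * iexp (s * X \<omega>)) =
         (CLINT \<omega>|M. of_real (P \<omega>) * E \<omega> + a * (Z \<omega> * E \<omega>) + b * (cnj (Z \<omega>) * E \<omega>))"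
        by (simp add: V E_def algebra_simps)
      also have "\<dots> = char \<nu> s * ((CLINT \<omega>|M. of_real (P \<omega>)) + a * (CLINT \<omega>|M. Z \<omega>) + b * (CLINT \<omega>|M. cnj (Z \<omega>)))"
        proof -
        have "complex_integrable M (\<lambda>\<omega>. of_real (P \<omega>))" "complex_integrable M (\<lambda>\<omega>. cnj (Z \<omega>))"
          using P intZ by auto
        note int = E(1)[OF this(1)] E(1)[OF intZ] E(1)[OF this(2)]
        show ?thesis
          using int by (simp add: E(2-4) distrib_left del: integral_cnj integral_complex_of_real)
      qed
      also have "(CLINT \<omega>|M. of_real (P \<omega>)) + a * (CLINT \<omega>|M. Z \<omega>) + b * (CLINT \<omega>|M. cnj (Z \<omega>))
          = (CLINT \<omega>|M. complex_of_real (V \<omega>))"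
        using P intZ by (simp add: V del: integral_cnj integral_complex_of_real)
      finally show "(CLINT \<omega>|M. of_real (V \<omega>) * iexp (s * X \<omega>)) = char \<nu> s * of_real (expectation V)" by simp
    qed
  qed
  have 0: "expectation (\<lambda>\<omega>. P \<omega> * indicator B (X \<omega>)) = measure \<nu> B * expectation P"
    by (rule comb[of P 0 0]) (use P0 in auto)
  have 1: "expectation (\<lambda>\<omega>. (P \<omega> + Re (Z \<omega>)) * indicator B (X \<omega>)) = measure \<nu> B * expectation (\<lambda>\<omega>. P \<omega> + Re (Z \<omega>))"
  proof (rule comb[of _ "1/2" "1/2"])
    show "0 \<le> P \<omega> + Re (Z \<omega>)" for \<omega> using ReP[of \<omega>] by linarith
  qed (auto simp: complex_eq_iff)
  have 2: "expectation (\<lambda>\<omega>. (P \<omega> + Im (Z \<omega>)) * indicator B (X \<omega>)) = measure \<nu> B * expectation (\<lambda>\<omega>. P \<omega> + Im (Z \<omega>))"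
  \<comment> \<open>The imaginary part is \<open>-\<i>/2\<close> times \<open>Z \<omega>\<close>
    plus \<open>\<i>/2\<close> times its conjugate.\<close>
  proof (rule comb[of _ "-\<i>/2" "\<i>/2"])
    show "0 \<le> P \<omega> + Im (Z \<omega>)" for \<omega> using ImP[of \<omega>] by linarith
  qed (auto simp: complex_eq_iff)
  \<comment> \<open>Subtracting the identity for \<open>P\<close> alone isolates the real part, and
    below likewise the imaginary part.\<close>
  have Re: "expectation (\<lambda>\<omega>. Re (Z \<omega>) * indicator B (X \<omega>)) = measure \<nu> B * expectation (\<lambda>\<omega>. Re (Z \<omega>))"
    using 0 1 P intZ by (simp add: distrib_right distrib_left indr)
  have Im: "expectation (\<lambda>\<omega>. Im (Z \<omega>) * indicator B (X \<omega>)) = measure \<nu> B * expectation (\<lambda>\<omega>. Im (Z \<omega>))"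
    using 0 2 P intZ by (simp add: distrib_right distrib_left indr)
  have ind: "Re (indicator B x) = indicator B x" "Im (indicator B x) = 0" for x
    by (auto simp: indicator_def)
  show ?thesis
    using Re Im intZ indc[OF intZ] by (simp add: complex_eq_iff integral_Re[symmetric] integral_Im[symmetric] ind
       del: integral_Re integral_Im)
qed

text \<open>
  Interpolates between the joint characteristic function (\<open>J = {}\<close>) and the joint law (\<open>J = I\<close>),
  so that the one-dimensional Levy theorem can be applied to one coordinate at a time.
\<close>
lemma (in prob_space) prob_of_char:
  fixes X :: "'i \<Rightarrow> 'a \<Rightarrow> real" and \<nu> :: "'i \<Rightarrow> real measure"
  assumes I: "finite I" and X: "\<And>i. i \<in> I \<Longrightarrow> X i \<in> borel_measurable M"
    and \<nu>: "\<And>i. i \<in> I \<Longrightarrow> real_distribution (\<nu> i)"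
    and char: "\<And>t. (CLINT \<omega>|M. iexp (\<Sum>i\<in>I. t i * X i \<omega>)) = (\<Prod>i\<in>I. char (\<nu> i) (t i))"
    and J: "J \<subseteq> I" and A: "\<And>i. i \<in> I \<Longrightarrow> A i \<in> sets borel"
  shows "(CLINT \<omega>|M. of_real (\<Prod>j\<in>J. indicator (A j) (X j \<omega>)) * iexp (\<Sum>i\<in>I - J. t i * X i \<omega>))
    = of_real (\<Prod>j\<in>J. measure (\<nu> j) (A j)) * (\<Prod>i\<in>I - J. char (\<nu> i) (t i))"
  using finite_subset[OF J I] J
proof (induction J arbitrary: t rule: finite_induct)
  case empty
  then show ?case using char[of t] by simp
next
  case (insert k J)
  then have k: "k \<in> I" "k \<notin> J" "J \<subseteq> I" by auto
  define P :: "'a \<Rightarrow> real" where "P \<omega> = (\<Prod>j\<in>J. indicator (A j) (X j \<omega>))" for \<omega>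
  define \<theta> where "\<theta> \<omega> = (\<Sum>i\<in>I - insert k J. t i * X i \<omega>)" for \<omega>
  \<comment> \<open>The factor \<open>r\<close> will be 0, 1 and -1: this covers the weight
    \<open>P\<close> alone, the weight times the remaining exponential, and the conjugate of the
    latter.\<close>
  define \<psi> where "\<psi> r = of_real (\<Prod>j\<in>J. measure (\<nu> j) (A j)) * (\<Prod>i\<in>I - insert k J. char (\<nu> i) (r * t i))" for r
  have split: "I - J = insert k (I - insert k J)" using k by auto
  have fin: "finite (I - insert k J)" using I by auto
  have H: "(CLINT \<omega>|M. of_real (P \<omega>) * iexp (s * X k \<omega> + r * \<theta> \<omega>)) = char (\<nu> k) s * \<psi> r" for s r
  proof -
    \<comment> \<open>The induction hypothesis holds for all \<open>t\<close>, so it may be used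
      with coefficient \<open>s\<close> at \<open>k\<close> and rescaled coefficients
      elsewhere.\<close>
    let ?t = "\<lambda>i. if i = k then s else r * t i"
    have "(\<Sum>i\<in>I - J. ?t i * X i \<omega>) = s * X k \<omega> + r * \<theta> \<omega>" for \<omega>
      unfolding split \<theta>_def using fin by (subst sum.insert) (auto simp: sum_distrib_left mult.assoc intro!: sum.cong)
    moreover have "(\<Prod>i\<in>I - J. char (\<nu> i) (?t i)) = char (\<nu> k) s * (\<Prod>i\<in>I - insert k J. char (\<nu> i) (r * t i))"
      unfolding split using fin by (subst prod.insert) (auto intro!: prod.cong)
    ultimately show ?thesis using insert.IH[OF k(3), of ?t] by (simp add: P_def \<psi>_def mult_ac)
  qed
  have H0: "(CLINT \<omega>|M. of_real (P \<omega>) * iexp (r * \<theta> \<omega>)) = \<psi> r" for r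
    using H[of 0 r] real_distribution.char_zero[OF \<nu>[OF k(1)]] by simp
  have X'[measurable]: "X i \<in> borel_measurable M" if "i \<in> J" for i using X that k by auto
  have Xk[measurable]: "X k \<in> borel_measurable M" using X k by auto
  have A'[measurable]: "A i \<in> sets borel" if "i \<in> J" for i using A that k by auto
  have [measurable]: "P \<in> borel_measurable M" unfolding P_def by measurable
  have [measurable]: "\<theta> \<in> borel_measurable M" unfolding \<theta>_def using X by (intro borel_measurable_sum) auto
  have P01: "0 \<le> P \<omega>" "P \<omega> \<le> 1" for \<omega>
    unfolding P_def by (auto intro!: prod_nonneg prod_le_1 simp: indicator_def)
  have "(CLINT \<omega>|M. (of_real (P \<omega>) * iexp (\<theta> \<omega>)) * indicator (A k) (X k \<omega>))
      = of_real (measure (\<nu> k) (A k)) * (CLINT \<omega>|M. of_real (P \<omega>) * iexp (\<theta> \<omega>))"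
  proof (rule complex_weighted_law_unique[where P = P])
    show "integrable M P"
      by (rule integrable_const_bound[of _ 1]) (use P01 in auto)
    show "cmod (complex_of_real (P \<omega>) * iexp (\<theta> \<omega>)) \<le> P \<omega>" for \<omega>
      using P01[of \<omega>] by (simp add: norm_mult)
    show "(CLINT \<omega>|M. of_real (P \<omega>) * iexp (s * X k \<omega>)) = char (\<nu> k) s * (CLINT \<omega>|M. of_real (P \<omega>))" for s
      using H[of s 0] H0[of 0] by simp
    show "(CLINT \<omega>|M. of_real (P \<omega>) * iexp (\<theta> \<omega>) * iexp (s * X k \<omega>))
        = char (\<nu> k) s * (CLINT \<omega>|M. of_real (P \<omega>) * iexp (\<theta> \<omega>))" for s
      using H[of s 1] H0[of 1] by (simp add: exp_add distrib_left mult_ac)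
    show "(CLINT \<omega>|M. cnj (of_real (P \<omega>) * iexp (\<theta> \<omega>)) * iexp (s * X k \<omega>))
        = char (\<nu> k) s * (CLINT \<omega>|M. cnj (of_real (P \<omega>) * iexp (\<theta> \<omega>)))" for s
      using H[of s "-1"] H0[of "-1"] by (simp add: exp_cnj exp_add distrib_left exp_diff exp_minus field_simps del: integral_cnj)
  qed (use A k \<nu> in auto)
  moreover have "of_real (\<Prod>j\<in>insert k J. indicator (A j) (X j \<omega>)) * iexp (\<Sum>i\<in>I - insert k J. t i * X i \<omega>)
      = (of_real (P \<omega>) * iexp (\<theta> \<omega>)) * indicator (A k) (X k \<omega>)" for \<omega>
    using insert.hyps by (simp add: P_def \<theta>_def indicator_def)
  moreover have "of_real (measure (\<nu> k) (A k)) * \<psi> 1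
     = of_real (\<Prod>j\<in>insert k J. measure (\<nu> j) (A j)) * (\<Prod>i\<in>I - insert k J. char (\<nu> i) (t i))"
    using insert.hyps by (simp add: \<psi>_def mult_ac)
  ultimately show ?case using H0[of 1] by (simp del: of_real_prod)
qed

text \<open>The case \<open>J = I\<close> of the interpolation, where no exponential is left; the
  mean of the product of indicators is the probability of a rectangle.\<close>

lemma (in prob_space) prob_Inter_of_char:
  fixes X :: "'i \<Rightarrow> 'a \<Rightarrow> real" and \<nu> :: "'i \<Rightarrow> real measure"
  assumes I: "finite I" "I \<noteq> {}" and X: "\<And>i. i \<in> I \<Longrightarrow> X i \<in> borel_measurable M"
    and \<nu>: "\<And>i. i \<in> I \<Longrightarrow> real_distribution (\<nu> i)"
    and char: "\<And>t. (CLINT \<omega>|M. iexp (\<Sum>i\<in>I. t i * X i \<omega>)) = (\<Prod>i\<in>I. char (\<nu> i) (t i))"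
    and A: "\<And>i. i \<in> I \<Longrightarrow> A i \<in> sets borel"
  shows "prob (\<Inter>i\<in>I. X i -` A i \<inter> space M) = (\<Prod>i\<in>I. measure (\<nu> i) (A i))"
proof -
  have "(CLINT \<omega>|M. complex_of_real (\<Prod>j\<in>I. indicator (A j) (X j \<omega>))) = of_real (\<Prod>j\<in>I. measure (\<nu> j) (A j))"
    using prob_of_char[OF I(1) X \<nu> char order_refl A] by (simp del: of_real_prod integral_complex_of_real)
  then have "expectation (\<lambda>\<omega>. \<Prod>j\<in>I. indicator (A j) (X j \<omega>)) = (\<Prod>j\<in>I. measure (\<nu> j) (A j))"
    by (simp only: integral_complex_of_real of_real_eq_iff)
  moreover have "expectation (\<lambda>\<omega>. \<Prod>j\<in>I. indicator (A j) (X j \<omega>))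
      = expectation (indicat_real (\<Inter>i\<in>I. X i -` A i \<inter> space M))"
  proof (rule Bochner_Integration.integral_cong[OF refl])
    fix \<omega> assume \<omega>: "\<omega> \<in> space M"
    show "(\<Prod>j\<in>I. indicator (A j) (X j \<omega>)) = (indicator (\<Inter>i\<in>I. X i -` A i \<inter> space M) \<omega> :: real)"
    proof (cases "\<forall>i\<in>I. X i \<omega> \<in> A i")
      case True
      then show ?thesis using \<omega> by (auto simp: indicator_def)
    next
      case False
      then have "(\<Prod>j\<in>I. indicator (A j) (X j \<omega>)) = (0::real)" using I by (auto simp: prod_zero_iff indicator_def)
      then show ?thesis using False by (auto simp: indicator_def)
    qed
  qed
  \<comment> \<open>For empty \<open>I\<close> the intersection would be \<open>UNIV\<close> and
    could exceed the sample space.\<close>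
  moreover have "(\<Inter>i\<in>I. X i -` A i \<inter> space M) \<subseteq> space M" using \<open>I \<noteq> {}\<close> by auto
  ultimately show ?thesis by (simp add: Int_absorb2)
qed

text \<open>Rectangles with the full line in all other coordinates recover the marginal, so the
  \<open>\<nu> i\<close> are necessarily the laws of the \<open>X i\<close>.\<close>

lemma (in prob_space) distr_of_char:
  fixes X :: "'i \<Rightarrow> 'a \<Rightarrow> real" and \<nu> :: "'i \<Rightarrow> real measure"
  assumes I: "finite I" and X: "\<And>i. i \<in> I \<Longrightarrow> X i \<in> borel_measurable M"
    and \<nu>: "\<And>i. i \<in> I \<Longrightarrow> real_distribution (\<nu> i)"
    and char: "\<And>t. (CLINT \<omega>|M. iexp (\<Sum>i\<in>I. t i * X i \<omega>)) = (\<Prod>i\<in>I. char (\<nu> i) (t i))"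
    and i: "i \<in> I"
  shows "distr M borel (X i) = \<nu> i"
proof -
  interpret N: real_distribution "\<nu> i" using \<nu>[OF i] .
  have single: "prob (X i -` B \<inter> space M) = measure (\<nu> i) B" if B: "B \<in> sets borel" for B
  proof -
    have one: "measure (\<nu> j) UNIV = 1" if "j \<in> I" for j
      using \<nu>[OF that] prob_space.prob_space[of "\<nu> j"]
      by (simp add: real_distribution_def real_distribution.space_eq_univ)
    have "(\<Inter>j\<in>I. X j -` (if j = i then B else UNIV) \<inter> space M) = X i -` B \<inter> space M"
      using i by auto
    moreover have "(\<Prod>j\<in>I. measure (\<nu> j) (if j = i then B else UNIV)) = (\<Prod>j\<in>I. if j = i then measure (\<nu> i) B else 1)"
      using one by (intro prod.cong) auto
    moreover have "prob (\<Inter>j\<in>I. X j -` (if j = i then B else UNIV) \<inter> space M)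
        = (\<Prod>j\<in>I. measure (\<nu> j) (if j = i then B else UNIV))"
      by (rule prob_Inter_of_char[OF I _ X \<nu> char]) (use i B in auto)
    ultimately show ?thesis using i I by (simp add: prod.delta)
  qed
  show ?thesis
    by (rule measure_eqI) (use single X[OF i] in
      \<open>auto simp: emeasure_distr emeasure_eq_measure N.emeasure_eq_measure\<close>)
qed

text \<open>Probabilities of rectangles factor into the measures \<open>\<nu> i\<close>, which are
  the marginal laws. Borel sets are stable under intersection, so rectangles decide
  independence.\<close>

lemma (in prob_space) indep_vars_of_char:
  fixes X :: "'i \<Rightarrow> 'a \<Rightarrow> real" and \<nu> :: "'i \<Rightarrow> real measure"
  assumes I: "finite I" and X: "\<And>i. i \<in> I \<Longrightarrow> X i \<in> borel_measurable M"
    and \<nu>: "\<And>i. i \<in> I \<Longrightarrow> real_distribution (\<nu> i)"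
    and char: "\<And>t. (CLINT \<omega>|M. iexp (\<Sum>i\<in>I. t i * X i \<omega>)) = (\<Prod>i\<in>I. char (\<nu> i) (t i))"
  shows "indep_vars (\<lambda>_. borel) X I"
proof (cases "I = {}")
  case True
  then show ?thesis by (simp add: indep_vars_def indep_sets_def)
next
  case False
  have single: "measure (\<nu> i) B = prob (X i -` B \<inter> space M)" if "i \<in> I" "B \<in> sets borel" for i B
    using distr_of_char[OF I X \<nu> char that(1)] X that by (metis measure_distr)
  show ?thesis
  proof (subst indep_vars_finite[OF False I, where E = "\<lambda>_. sets borel"])
    show "\<forall>A\<in>I \<rightarrow> sets borel. prob (\<Inter>j\<in>I. X j -` A j \<inter> space M) = (\<Prod>j\<in>I. prob (X j -` A j \<inter> space M))"
    proof
      fix A assume A: "A \<in> I \<rightarrow> sets (borel :: real measure)"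
      have "prob (\<Inter>j\<in>I. X j -` A j \<inter> space M) = (\<Prod>j\<in>I. measure (\<nu> j) (A j))"
        by (rule prob_Inter_of_char[OF I False X \<nu> char]) (use A in auto)
      also have "\<dots> = (\<Prod>j\<in>I. prob (X j -` A j \<inter> space M))"
        using A by (intro prod.cong refl single) auto
      finally show "prob (\<Inter>j\<in>I. X j -` A j \<inter> space M) = (\<Prod>j\<in>I. prob (X j -` A j \<inter> space M))" .
    qed
    show "sets borel = sigma_sets (space borel) (sets (borel :: real measure))"
      by (rule sets.sigma_sets_eq[symmetric])
  qed (use X in \<open>auto simp: Int_stable_def\<close>)
qed

section \<open>Maximal inequality\<close>

text \<open>Partial sums frozen from the first time their absolute value reaches \<open>a\<close>.
  The current value alone decides whether the next term is added, so the switch depends only on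
  earlier terms.\<close>

primrec stopped_sum :: "real \<Rightarrow> (nat \<Rightarrow> real) \<Rightarrow> nat \<Rightarrow> real" where
  "stopped_sum a x 0 = 0"
| "stopped_sum a x (Suc n) =
     (if a \<le> \<bar>stopped_sum a x n\<bar> then stopped_sum a x n else stopped_sum a x n + x n)"

text \<open>A value that has reached the level stays frozen there, so a value still below it means
  that no freezing has occurred.\<close>

lemma stopped_sum_below:
  "\<bar>stopped_sum a x n\<bar> < a \<Longrightarrow>
    stopped_sum a x n = (\<Sum>i<n. x i) \<and> (\<forall>k\<le>n. \<bar>stopped_sum a x k\<bar> < a)"
proof (induction n)
  case (Suc n)
  then have "\<bar>stopped_sum a x n\<bar> < a" by (auto split: if_splits)
  with Suc show ?case by (auto simp: le_Suc_eq)
qed simp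

text \<open>The final stopped value remembers whether an earlier partial sum reached the level; this
  reduces an event about a maximum to one about a single variable.\<close>

lemma stopped_sum_ge:
  assumes "k \<le> n" "a \<le> \<bar>\<Sum>i<k. x i\<bar>"
  shows "a \<le> \<bar>stopped_sum a x n\<bar>"
proof (rule ccontr)
  assume "\<not> a \<le> \<bar>stopped_sum a x n\<bar>"
  then have "\<bar>stopped_sum a x k\<bar> < a" using stopped_sum_below[of a x n] assms(1) by simp
  then show False using stopped_sum_below[of a x k] assms(2) by simp
qed

lemma stopped_sum_cong:
  "(\<And>i. i < n \<Longrightarrow> x i = y i) \<Longrightarrow> stopped_sum a x n = stopped_sum a y n"
  by (induction n) auto

lemma measurable_stopped_sum:
  "(\<And>i. i < n \<Longrightarrow> (\<lambda>\<omega>. X \<omega> i) \<in> borel_measurable N) \<Longrightarrow>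
    (\<lambda>\<omega>. stopped_sum a (X \<omega>) n) \<in> borel_measurable N"
proof (induction n)
  case (Suc n)
  then have [measurable]: "(\<lambda>\<omega>. stopped_sum a (X \<omega>) n) \<in> borel_measurable N"
    "(\<lambda>\<omega>. X \<omega> n) \<in> borel_measurable N" by auto
  show ?case by simp
qed simp

text \<open>
  The increment of the stopped sum at \<open>k\<close> is \<open>X k\<close> switched on or off by the past, hence
  uncorrelated with the stopped sum itself.
\<close>
lemma (in prob_space)
  fixes X :: "nat \<Rightarrow> 'a \<Rightarrow> real"
  assumes ind: "indep_vars (\<lambda>_. borel) X {..<n}"
    and sq: "\<And>i. i < n \<Longrightarrow> integrable M (\<lambda>\<omega>. (X i \<omega>)\<^sup>2)"
    and mean: "\<And>i. i < n \<Longrightarrow> expectation (X i) = 0"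
  shows integrable_stopped_sum: "integrable M (\<lambda>\<omega>. (stopped_sum a (\<lambda>i. X i \<omega>) n)\<^sup>2)"
    and second_moment_stopped_sum:
      "expectation (\<lambda>\<omega>. (stopped_sum a (\<lambda>i. X i \<omega>) n)\<^sup>2) \<le> (\<Sum>i<n. expectation (\<lambda>\<omega>. (X i \<omega>)\<^sup>2))"
proof -
  have X: "X i \<in> borel_measurable M" if "i < n" for i
    using ind that by (auto simp: indep_vars_def)
  define T where "T k \<omega> = stopped_sum a (\<lambda>i. X i \<omega>) k" for k \<omega>
  have "integrable M (\<lambda>\<omega>. (T k \<omega>)\<^sup>2) \<and>
    expectation (\<lambda>\<omega>. (T k \<omega>)\<^sup>2) \<le> (\<Sum>i<k. expectation (\<lambda>\<omega>. (X i \<omega>)\<^sup>2))" if "k \<le> n" for k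
    using that
  proof (induction k)
    case 0
    then show ?case by (simp add: T_def)
  next
    case (Suc k)
    \<comment> \<open>\<open>h\<close> keeps the current value while the sum is running and is 0
      once it is frozen. It is bounded by \<open>\<bar>a\<bar>\<close>, so
      \<open>h (T k \<omega>)\<close> is integrable.\<close>
    define h where "h t = (if a \<le> \<bar>t\<bar> then 0 else t)" for t :: real
    have [measurable]: "h \<in> borel_measurable borel" unfolding h_def by simp
    have Tk[measurable]: "T k \<in> borel_measurable M"
      using X Suc.prems unfolding T_def[abs_def] by (intro measurable_stopped_sum) auto
    have Xk[measurable]: "X k \<in> borel_measurable M" using X Suc.prems by auto
    have intT: "integrable M (\<lambda>\<omega>. (T k \<omega>)\<^sup>2)" using Suc by auto
    have intX2: "integrable M (\<lambda>\<omega>. (X k \<omega>)\<^sup>2)" using sq Suc.prems by auto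
    have intX: "integrable M (X k)"
      using intX2 Xk by (rule square_integrable_imp_integrable[rotated])
    have inth: "integrable M (\<lambda>\<omega>. h (T k \<omega>))"
      by (rule integrable_const_bound[of _ "\<bar>a\<bar>"]) (auto simp: h_def)
    \<comment> \<open>\<open>X k\<close> is independent of the block of all earlier terms, and the
      stopped sum at \<open>k\<close> is a function of that block.\<close>
    have "indep_var (PiM {..<k} (\<lambda>_. borel)) (\<lambda>\<omega>. restrict (\<lambda>i. X i \<omega>) {..<k})
        (PiM {k} (\<lambda>_. borel)) (\<lambda>\<omega>. restrict (\<lambda>i. X i \<omega>) {k})"
      by (rule indep_var_restrict[OF ind]) (use Suc.prems in auto)
    then have "indep_var borel ((\<lambda>x. h (stopped_sum a x k)) \<circ> (\<lambda>\<omega>. restrict (\<lambda>i. X i \<omega>) {..<k}))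
        borel ((\<lambda>x. x k) \<circ> (\<lambda>\<omega>. restrict (\<lambda>i. X i \<omega>) {k}))"
    proof (rule indep_var_compose)
      have [measurable]: "(\<lambda>x. stopped_sum a x k) \<in> borel_measurable (PiM {..<k} (\<lambda>_. borel))"
        by (rule measurable_stopped_sum) simp
      show "(\<lambda>x. h (stopped_sum a x k)) \<in> borel_measurable (PiM {..<k} (\<lambda>_. borel))" by measurable
    qed simp
    moreover have "(\<lambda>x. h (stopped_sum a x k)) \<circ> (\<lambda>\<omega>. restrict (\<lambda>i. X i \<omega>) {..<k}) = (\<lambda>\<omega>. h (T k \<omega>))"
      by (auto simp: T_def fun_eq_iff intro!: arg_cong[of _ _ h] stopped_sum_cong)
    moreover have "(\<lambda>x. x k) \<circ> (\<lambda>\<omega>. restrict (\<lambda>i. X i \<omega>) {k}) = X k"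
      by (auto simp: fun_eq_iff)
    ultimately have indk: "indep_var borel (\<lambda>\<omega>. h (T k \<omega>)) borel (X k)" by simp
    have intc: "integrable M (\<lambda>\<omega>. h (T k \<omega>) * X k \<omega>)"
      by (rule indep_var_integrable[OF indk inth intX])
    have cross: "expectation (\<lambda>\<omega>. h (T k \<omega>) * X k \<omega>) = 0"
      using indep_var_lebesgue_integral[OF indk inth intX] mean Suc.prems by simp
    have bound: "integrable M (\<lambda>\<omega>. (T k \<omega>)\<^sup>2 + 2 * (h (T k \<omega>) * X k \<omega>) + (X k \<omega>)\<^sup>2)"
      using intT intc intX2 by auto
    \<comment> \<open>Equality while running; after freezing the mixed term is 0 and the right side
      is larger by \<open>(X k \<omega>)\<^sup>2\<close>.\<close>
    have le: "(T (Suc k) \<omega>)\<^sup>2 \<le> (T k \<omega>)\<^sup>2 + 2 * (h (T k \<omega>) * X k \<omega>) + (X k \<omega>)\<^sup>2" for \<omega>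
      by (simp add: T_def h_def power2_sum)
    have int: "integrable M (\<lambda>\<omega>. (T (Suc k) \<omega>)\<^sup>2)"
    proof (rule Bochner_Integration.integrable_bound[OF bound])
      have [measurable]: "T (Suc k) \<in> borel_measurable M"
        using X Suc.prems unfolding T_def[abs_def] by (intro measurable_stopped_sum) auto
      show "(\<lambda>\<omega>. (T (Suc k) \<omega>)\<^sup>2) \<in> borel_measurable M" by measurable
      show "AE \<omega> in M. norm ((T (Suc k) \<omega>)\<^sup>2) \<le> norm ((T k \<omega>)\<^sup>2 + 2 * (h (T k \<omega>) * X k \<omega>) + (X k \<omega>)\<^sup>2)"
        using le by (auto intro!: AE_I2 order_trans[OF _ abs_ge_self])
    qed
    have "expectation (\<lambda>\<omega>. (T (Suc k) \<omega>)\<^sup>2)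
        \<le> expectation (\<lambda>\<omega>. (T k \<omega>)\<^sup>2 + 2 * (h (T k \<omega>) * X k \<omega>) + (X k \<omega>)\<^sup>2)"
      using le by (intro integral_mono int bound) auto
    also have "\<dots> = expectation (\<lambda>\<omega>. (T k \<omega>)\<^sup>2) + expectation (\<lambda>\<omega>. (X k \<omega>)\<^sup>2)"
      using intT intc intX2 cross by simp
    finally show ?case using int Suc by simp
  qed
  from this[of n] show "integrable M (\<lambda>\<omega>. (stopped_sum a (\<lambda>i. X i \<omega>) n)\<^sup>2)"
    "expectation (\<lambda>\<omega>. (stopped_sum a (\<lambda>i. X i \<omega>) n)\<^sup>2) \<le> (\<Sum>i<n. expectation (\<lambda>\<omega>. (X i \<omega>)\<^sup>2))"
    by (auto simp: T_def)
qed

text \<open>Markov's inequality for the squared stopped sum, which is at least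
  \<open>a\<^sup>2\<close> on the maximal event and whose mean is at most the sum of the
  variances.\<close>

theorem (in prob_space) Kolmogorov_maximal_inequality:
  fixes X :: "nat \<Rightarrow> 'a \<Rightarrow> real"
  assumes ind: "indep_vars (\<lambda>_. borel) X {..<n}"
    and sq: "\<And>i. i < n \<Longrightarrow> integrable M (\<lambda>\<omega>. (X i \<omega>)\<^sup>2)"
    and mean: "\<And>i. i < n \<Longrightarrow> expectation (X i) = 0"
    and a: "0 < a"
  shows "prob {\<omega>\<in>space M. \<exists>k\<le>n. a \<le> \<bar>\<Sum>i<k. X i \<omega>\<bar>} \<le> (\<Sum>i<n. expectation (\<lambda>\<omega>. (X i \<omega>)\<^sup>2)) / a\<^sup>2"
proof -
  define T where "T \<omega> = stopped_sum a (\<lambda>i. X i \<omega>) n" for \<omega>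
  have X: "X i \<in> borel_measurable M" if "i < n" for i
    using ind that by (auto simp: indep_vars_def)
  have [measurable]: "T \<in> borel_measurable M"
    unfolding T_def[abs_def] using X by (intro measurable_stopped_sum) auto
  have "prob {\<omega>\<in>space M. \<exists>k\<le>n. a \<le> \<bar>\<Sum>i<k. X i \<omega>\<bar>} \<le> prob {\<omega>\<in>space M. a\<^sup>2 \<le> (T \<omega>)\<^sup>2}"
  proof (rule finite_measure_mono)
    show "{\<omega>\<in>space M. \<exists>k\<le>n. a \<le> \<bar>\<Sum>i<k. X i \<omega>\<bar>} \<subseteq> {\<omega>\<in>space M. a\<^sup>2 \<le> (T \<omega>)\<^sup>2}"
      using a stopped_sum_ge by (fastforce simp: T_def abs_le_square_iff[symmetric])
  qed measurable
  also have "\<dots> \<le> expectation (\<lambda>\<omega>. (T \<omega>)\<^sup>2) / a\<^sup>2"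
    using a integrable_stopped_sum[OF ind sq mean]
    by (intro integral_Markov_inequality_measure[where A = "{}"]) (auto simp: T_def)
  also have "\<dots> \<le> (\<Sum>i<n. expectation (\<lambda>\<omega>. (X i \<omega>)\<^sup>2)) / a\<^sup>2"
    using second_moment_stopped_sum[OF ind sq mean] by (intro divide_right_mono) (auto simp: T_def)
  finally show ?thesis .
qed

section \<open>Monotone weights and suprema\<close>

text \<open>Summation by parts: with \<open>S k = (\<Sum>i<k. w i)\<close> the difference equals
  \<open>\<Sum>i<n. (t (Suc i) - t i) * S (Suc i)\<close>. The increments of \<open>t\<close> are
  nonnegative and telescope.\<close>

lemma abel_increasing_weights:
  fixes t w :: "nat \<Rightarrow> real"
  assumes mono: "\<And>i j. i \<le> j \<Longrightarrow> j \<le> n \<Longrightarrow> t i \<le> t j"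
    and K: "\<And>k. k \<le> n \<Longrightarrow> \<bar>\<Sum>i<k. w i\<bar> \<le> K"
  shows "\<bar>t n * (\<Sum>i<n. w i) - (\<Sum>i<n. t i * w i)\<bar> \<le> (t n - t 0) * K"
  using assms
proof (induction n)
  case (Suc n)
  have IH: "\<bar>t n * (\<Sum>i<n. w i) - (\<Sum>i<n. t i * w i)\<bar> \<le> (t n - t 0) * K"
    using Suc by simp
  have "\<bar>(t (Suc n) - t n) * (\<Sum>i<Suc n. w i)\<bar> \<le> (t (Suc n) - t n) * K"
    using Suc.prems(1)[of n "Suc n"] Suc.prems(2)[of "Suc n"]
    by (subst abs_mult) (auto intro!: mult_mono)
  with IH have "\<bar>(t (Suc n) - t n) * (\<Sum>i<Suc n. w i) + (t n * (\<Sum>i<n. w i) - (\<Sum>i<n. t i * w i))\<bar>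
     \<le> (t (Suc n) - t n) * K + (t n - t 0) * K"
    by linarith
  then show ?case by (simp add: algebra_simps)
qed simp

lemma abs_weighted_sum_le:
  fixes t w :: "nat \<Rightarrow> real"
  assumes mono: "\<And>i j. i \<le> j \<Longrightarrow> j < n \<Longrightarrow> t i \<le> t j"
    and t: "\<And>i. i < n \<Longrightarrow> 0 \<le> t i" "\<And>i. i < n \<Longrightarrow> t i \<le> 1"
    and K: "\<And>k. k \<le> n \<Longrightarrow> \<bar>\<Sum>i<k. w i\<bar> \<le> K"
  shows "\<bar>\<Sum>i<n. t i * w i\<bar> \<le> 2 * K"
proof -
  \<comment> \<open>A weight 1 at index \<open>n\<close> keeps monotonicity, as all weights are at
    most 1. The boundary term is then the full sum, at most \<open>K\<close>, and the remainder is
    at most \<open>(1 - s 0) * K\<close>, hence the factor 2.\<close>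
  define s where "s i = (if i < n then t i else 1)" for i
  have "\<bar>s n * (\<Sum>i<n. w i) - (\<Sum>i<n. s i * w i)\<bar> \<le> (s n - s 0) * K"
    by (rule abel_increasing_weights) (use mono t K in \<open>auto simp: s_def\<close>)
  moreover have "(s n - s 0) * K \<le> 1 * K"
    using t[of 0] K[of 0] by (intro mult_right_mono) (auto simp: s_def)
  moreover have "(\<Sum>i<n. s i * w i) = (\<Sum>i<n. t i * w i)" "s n = 1" by (auto simp: s_def)
  ultimately show ?thesis using K[of n] by simp
qed

section \<open>Suprema over dense index sets\<close>

lemma closure_nonneg_Rats: "closure ({0..} \<inter> \<rat>) = {0::real..}"
proof
  show "closure ({0..} \<inter> \<rat>) \<subseteq> {0::real..}" by (intro closure_minimal) auto
  show "{0..} \<subseteq> closure ({0..} \<inter> \<rat> :: real set)"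
  proof
    fix x :: real assume x: "x \<in> {0..}"
    show "x \<in> closure ({0..} \<inter> \<rat>)"
      unfolding closure_approachable
    proof (intro allI impI)
      fix e :: real assume "0 < e"
      then obtain r where "r \<in> \<rat>" "x < r" "r < x + e"
        using Rats_dense_in_real[of x "x + e"] by auto
      then show "\<exists>y\<in>{0..} \<inter> \<rat>. dist y x < e"
        using x by (intro bexI[of _ r]) (auto simp: dist_real_def)
    qed
  qed
qed

text \<open>A real upper bound on \<open>S\<close> extends to the closure by continuity. A point in
  the closure makes \<open>S\<close> nonempty, which excludes the supremum minus infinity.\<close>

lemma SUP_closure_continuous:
  fixes f :: "'a::metric_space \<Rightarrow> real"
  assumes f: "continuous_on (closure S) f"
  shows "(SUP x\<in>closure S. ereal (f x)) = (SUP x\<in>S. ereal (f x))"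
proof (rule antisym)
  show "(SUP x\<in>closure S. ereal (f x)) \<le> (SUP x\<in>S. ereal (f x))"
  proof (rule SUP_least)
    fix x assume x: "x \<in> closure S"
    then obtain z where z: "z \<in> S" by fastforce
    have upper: "ereal (f y) \<le> (SUP x\<in>S. ereal (f x))" if "y \<in> S" for y
      using that by (rule SUP_upper)
    show "ereal (f x) \<le> (SUP x\<in>S. ereal (f x))"
    proof (cases "SUP x\<in>S. ereal (f x)")
      case (real r)
      have "f x \<le> r"
        by (rule continuous_le_on_closure[OF f x]) (use upper real in simp)
      then show ?thesis using real by simp
    qed (use upper[OF z] in auto)
  qed
  show "(SUP x\<in>S. ereal (f x)) \<le> (SUP x\<in>closure S. ereal (f x))"
    by (intro SUP_subset_mono closure_subset) auto
qed

text \<open>Serves measurability: the supremum over all regularisation parameters becomes a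
  countable one.\<close>

lemma SUP_nonneg_reals_eq_Rats:
  fixes f :: "real \<Rightarrow> real"
  assumes "continuous_on {0..} f"
  shows "(SUP x\<in>{0..}. ereal (f x)) = (SUP x\<in>{0..} \<inter> \<rat>. ereal (f x))"
  using SUP_closure_continuous[of "{0..} \<inter> \<rat>" f] assms by (simp add: closure_nonneg_Rats)

section \<open>Rotation of Gaussian noise\<close>

text \<open>\<open>lborel\<close> and \<open>borel\<close> have the same measurable sets, so a
  density statement becomes an equation between laws, the form in which Levy uniqueness
  applies.\<close>

lemma (in prob_space) distributed_lborel_iff_distr:
  fixes X :: "'a \<Rightarrow> real"
  assumes "X \<in> borel_measurable M" "f \<in> borel_measurable borel"
  shows "distributed M lborel X f \<longleftrightarrow> distr M borel X = density lborel f"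
proof -
  have "distr M lborel X = distr M borel X" by (rule distr_cong) auto
  then show ?thesis using assms by (simp add: distributed_def)
qed

text \<open>Division by \<sigma> reduces to the known characteristic function of the standard normal
  law.\<close>

lemma (in prob_space) expectation_iexp_normal:
  fixes X :: "'a \<Rightarrow> real"
  assumes \<sigma>: "0 < \<sigma>" and X: "distributed M lborel X (\<lambda>t. ennreal (normal_density 0 \<sigma> t))"
  shows "(CLINT \<omega>|M. iexp (t * X \<omega>)) = of_real (exp (- (\<sigma>\<^sup>2 * t\<^sup>2) / 2))"
proof -
  have [measurable]: "X \<in> borel_measurable M" using X by (simp add: distributed_def)
  have "distributed M lborel (\<lambda>\<omega>. X \<omega> / \<sigma>) std_normal_density"
    using X normal_standard_normal_convert[OF \<sigma>, of X 0] by simp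
  then have D: "distr M borel (\<lambda>\<omega>. X \<omega> / \<sigma>) = std_normal_distribution"
    by (subst (asm) distributed_lborel_iff_distr) auto
  have "(CLINT \<omega>|M. iexp (t * X \<omega>)) = (CLINT \<omega>|M. iexp ((t * \<sigma>) * (X \<omega> / \<sigma>)))"
    using \<sigma> by simp
  also have "\<dots> = char (distr M borel (\<lambda>\<omega>. X \<omega> / \<sigma>)) (t * \<sigma>)"
    unfolding char_def by (subst integral_distr) auto
  also have "\<dots> = of_real (exp (- (\<sigma>\<^sup>2 * t\<^sup>2) / 2))"
    unfolding D char_std_normal_distribution by (simp add: power_mult_distrib mult.commute)
  finally show ?thesis .
qed

text \<open>The joint characteristic function of the noise depends on its argument only through the
  Euclidean norm, which \<open>U\<close> preserves. Rotated and original coordinates therefore share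
  it.\<close>

lemma (in prob_space)
  assumes \<sigma>: "0 < \<sigma>" and e: "gaussian_noise M n \<sigma> e" and U: "orthonormal_mat n U"
  shows indep_vars_rotated_noise:
      "indep_vars (\<lambda>_. borel) (\<lambda>i \<omega>. \<Sum>j<n. U $$ (j, i) * e \<omega> $ j) {..<n}"
    and distributed_rotated_noise: "i < n \<Longrightarrow>
      distributed M lborel (\<lambda>\<omega>. \<Sum>j<n. U $$ (j, i) * e \<omega> $ j) (\<lambda>t. ennreal (normal_density 0 \<sigma> t))"
proof -
  have Uc: "U \<in> carrier_mat n n" using U by (auto simp: orthonormal_mat_def)
  have ind: "indep_vars (\<lambda>_. borel) (\<lambda>i \<omega>. e \<omega> $ i) {..<n}"
    and D: "\<And>i. i < n \<Longrightarrow> distributed M lborel (\<lambda>\<omega>. e \<omega> $ i) (\<lambda>t. ennreal (normal_density 0 \<sigma> t))"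
    using e by (auto simp: gaussian_noise_def)
  have em[measurable]: "(\<lambda>\<omega>. e \<omega> $ i) \<in> borel_measurable M" if "i < n" for i
    using D[OF that] by (simp add: distributed_def)
  define X where "X i \<omega> = (\<Sum>j<n. U $$ (j, i) * e \<omega> $ j)" for i \<omega>
  have Xm: "X i \<in> borel_measurable M" if "i < n" for i
    unfolding X_def[abs_def] by (intro borel_measurable_sum borel_measurable_times) (use em in auto)
  \<comment> \<open>The target laws are those of the unrotated coordinates, so this one identity
    yields both independence and the marginals.\<close>
  have char: "(CLINT \<omega>|M. iexp (\<Sum>i\<in>{..<n}. t i * X i \<omega>))
      = (\<Prod>i\<in>{..<n}. char (distr M borel (\<lambda>\<omega>. e \<omega> $ i)) (t i))" for t
  proof -
    \<comment> \<open>Moves the rotation onto the argument: \<tau> is the image of \<open>t\<close>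
      under \<open>U\<close>.\<close>
    define \<tau> where "\<tau> j = (\<Sum>i<n. U $$ (j, i) * t i)" for j
    have norm: "(\<Sum>j<n. (\<tau> j)\<^sup>2) = (\<Sum>i<n. (t i)\<^sup>2)"
    proof -
      let ?t = "Matrix.vec n t"
      have "(\<Sum>j<n. (\<tau> j)\<^sup>2) = (l2norm (U *\<^sub>v ?t))\<^sup>2"
        using Uc by (subst l2norm_sq[of _ n]) (auto simp: \<tau>_def scalar_prod_def lessThan_atLeast0)
      also have "\<dots> = (\<Sum>i<n. (t i)\<^sup>2)"
        by (subst l2norm_orthonormal_mult[OF U]) (simp_all add: l2norm_sq[of _ n])
      finally show ?thesis .
    qed
    have char1: "char (distr M borel (\<lambda>\<omega>. e \<omega> $ i)) s = of_real (exp (- (\<sigma>\<^sup>2 * s\<^sup>2) / 2))" if "i < n" for i s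
      using em[OF that] expectation_iexp_normal[OF \<sigma> D[OF that], of s]
      unfolding char_def by (subst integral_distr) auto
    have "(\<Sum>i<n. t i * X i \<omega>) = (\<Sum>j<n. \<tau> j * e \<omega> $ j)" for \<omega>
      unfolding X_def \<tau>_def sum_distrib_left sum_distrib_right
      by (subst sum.swap) (simp add: mult_ac)
    then have "(CLINT \<omega>|M. iexp (\<Sum>i\<in>{..<n}. t i * X i \<omega>)) = (CLINT \<omega>|M. (\<Prod>j<n. iexp (\<tau> j * e \<omega> $ j)))"
      by (simp add: exp_sum sum_distrib_left)
    also have "\<dots> = (\<Prod>j<n. (CLINT \<omega>|M. iexp (\<tau> j * e \<omega> $ j)))"
    proof (rule indep_vars_lebesgue_integral)
      show "indep_vars (\<lambda>_. borel) (\<lambda>j \<omega>. iexp (\<tau> j * e \<omega> $ j)) {..<n}"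
        by (rule indep_vars_compose2[OF ind, where Y = "\<lambda>j x. iexp (\<tau> j * x)"]) simp
      show "complex_integrable M (\<lambda>\<omega>. iexp (\<tau> j * e \<omega> $ j))" if "j \<in> {..<n}" for j
        by (rule integrable_iexp) (use that in auto)
    qed simp
    also have "\<dots> = (\<Prod>j<n. of_real (exp (- (\<sigma>\<^sup>2 * (\<tau> j)\<^sup>2) / 2)))"
      using expectation_iexp_normal[OF \<sigma> D] by (intro prod.cong) auto
    also have "\<dots> = of_real (exp (- (\<sigma>\<^sup>2 * (\<Sum>j<n. (\<tau> j)\<^sup>2)) / 2))"
      by (simp add: exp_sum[symmetric] of_real_prod[symmetric] sum_distrib_left sum_negf sum_divide_distrib
          del: of_real_prod)
    also have "\<dots> = (\<Prod>i<n. of_real (exp (- (\<sigma>\<^sup>2 * (t i)\<^sup>2) / 2)))"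
      unfolding norm
      by (simp add: exp_sum[symmetric] of_real_prod[symmetric] sum_distrib_left sum_negf sum_divide_distrib
          del: of_real_prod)
    also have "\<dots> = (\<Prod>i\<in>{..<n}. char (distr M borel (\<lambda>\<omega>. e \<omega> $ i)) (t i))"
      using char1 by (intro prod.cong) auto
    finally show ?thesis .
  qed
  have \<nu>: "real_distribution (distr M borel (\<lambda>\<omega>. e \<omega> $ i))" if "i \<in> {..<n}" for i
    using em that by (intro real_distribution_distr) auto
  have "indep_vars (\<lambda>_. borel) X {..<n}"
    by (rule indep_vars_of_char[OF _ _ \<nu> char]) (use Xm in auto)
  then show "indep_vars (\<lambda>_. borel) (\<lambda>i \<omega>. \<Sum>j<n. U $$ (j, i) * e \<omega> $ j) {..<n}"
    by (simp only: X_def[abs_def])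
  have "distributed M lborel (X i) (\<lambda>t. ennreal (normal_density 0 \<sigma> t))" if "i < n" for i
  proof -
    have "distr M borel (X i) = distr M borel (\<lambda>\<omega>. e \<omega> $ i)"
      by (rule distr_of_char[OF _ _ \<nu> char]) (use Xm that in auto)
    then show ?thesis
      using D[OF that] Xm[OF that] em[OF that] by (simp add: distributed_lborel_iff_distr)
  qed
  then show "i < n \<Longrightarrow>
      distributed M lborel (\<lambda>\<omega>. \<Sum>j<n. U $$ (j, i) * e \<omega> $ j) (\<lambda>t. ennreal (normal_density 0 \<sigma> t))"
    by (simp only: X_def[abs_def])
qed

section \<open>Moments of the noise\<close>

lemma (in prob_space)
  assumes \<sigma>: "0 < \<sigma>" and X: "distributed M lborel X (\<lambda>t. ennreal (normal_density 0 \<sigma> t))"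
  shows integrable_normal_power: "integrable M (\<lambda>\<omega>. X \<omega> ^ k)"
    and expectation_normal_sq: "expectation (\<lambda>\<omega>. (X \<omega>)\<^sup>2) = \<sigma>\<^sup>2"
    and expectation_normal_4: "expectation (\<lambda>\<omega>. X \<omega> ^ 4) = 3 * \<sigma> ^ 4"
proof -
  show "integrable M (\<lambda>\<omega>. X \<omega> ^ k)"
    using integrable_normal_moment[OF \<sigma>, of 0 k]
    by (subst distributed_integrable[OF X, symmetric]) auto
  show "expectation (\<lambda>\<omega>. (X \<omega>)\<^sup>2) = \<sigma>\<^sup>2"
    using integral_normal_moment_even[OF \<sigma>, of 0 1]
    by (subst distributed_integral[OF X, symmetric]) (auto simp: eval_nat_numeral)
  show "expectation (\<lambda>\<omega>. X \<omega> ^ 4) = 3 * \<sigma> ^ 4"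
    using integral_normal_moment_even[OF \<sigma>, of 0 2] \<sigma>
    by (subst distributed_integral[OF X, symmetric]) (auto simp: fact_numeral power_divide power_mult[symmetric])
qed

section \<open>Tail bound for the supremum\<close>

text \<open>With \<open>(p + q)\<^sup>2 \<le> 2 * p\<^sup>2 + 2 * q\<^sup>2\<close> no third moment
  enters. The mean of \<open>((X \<omega>)\<^sup>2 - \<sigma>\<^sup>2)\<^sup>2\<close> is
  \<open>2 * \<sigma> ^ 4\<close>, whence the term \<open>4 * \<sigma> ^ 4\<close>;
  \<open>g \<le> 1\<close> lets \<open>1 / g\<^sup>2\<close> be absorbed into
  \<open>1 / g ^ 4\<close>.\<close>

lemma (in prob_space)
  fixes X :: "'a \<Rightarrow> real"
  assumes \<sigma>: "0 < \<sigma>" and X: "distributed M lborel X (\<lambda>t. ennreal (normal_density 0 \<sigma> t))"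
    and g: "0 < g" "g \<le> 1" and b: "\<bar>b\<bar> \<le> B"
  shows integrable_noise_term_sq: "integrable M (\<lambda>\<omega>. (((X \<omega>)\<^sup>2 - \<sigma>\<^sup>2) / g\<^sup>2 + b * X \<omega> / g)\<^sup>2)"
    and expectation_noise_term: "expectation (\<lambda>\<omega>. ((X \<omega>)\<^sup>2 - \<sigma>\<^sup>2) / g\<^sup>2 + b * X \<omega> / g) = 0"
    and expectation_noise_term_sq:
      "expectation (\<lambda>\<omega>. (((X \<omega>)\<^sup>2 - \<sigma>\<^sup>2) / g\<^sup>2 + b * X \<omega> / g)\<^sup>2) \<le> (4 * \<sigma> ^ 4 + 2 * B\<^sup>2 * \<sigma>\<^sup>2) * (1 / g ^ 4)"
proof -
  note int = integrable_normal_power[OF \<sigma> X]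
  have int1: "integrable M X" using int[of 1] by simp
  have [measurable]: "X \<in> borel_measurable M" using int1 by auto
  have mean: "expectation X = 0"
    using normal_distributed_expectation[OF \<sigma> X] .
  show "expectation (\<lambda>\<omega>. ((X \<omega>)\<^sup>2 - \<sigma>\<^sup>2) / g\<^sup>2 + b * X \<omega> / g) = 0"
    using int[of 2] int1 by (simp add: expectation_normal_sq[OF \<sigma> X] mean prob_space)
  define D where "D \<omega> = 2 * (X \<omega> ^ 4 - 2 * \<sigma>\<^sup>2 * (X \<omega>)\<^sup>2 + \<sigma> ^ 4) / g ^ 4 + 2 * b\<^sup>2 * (X \<omega>)\<^sup>2 / g\<^sup>2" for \<omega>
  have intD: "integrable M D"
    unfolding D_def[abs_def] using int[of 2] int[of 4] by auto
  have le: "(((X \<omega>)\<^sup>2 - \<sigma>\<^sup>2) / g\<^sup>2 + b * X \<omega> / g)\<^sup>2 \<le> D \<omega>" for \<omega>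
  proof -
    have "(p + q)\<^sup>2 \<le> 2 * p\<^sup>2 + 2 * q\<^sup>2" for p q :: real
      using sum_squares_bound[of p q] by (simp add: power2_sum)
    from this[of "((X \<omega>)\<^sup>2 - \<sigma>\<^sup>2) / g\<^sup>2" "b * X \<omega> / g"] show ?thesis
      by (simp add: D_def power_divide power_mult_distrib power2_diff algebra_simps flip: power_mult)
  qed
  show int2: "integrable M (\<lambda>\<omega>. (((X \<omega>)\<^sup>2 - \<sigma>\<^sup>2) / g\<^sup>2 + b * X \<omega> / g)\<^sup>2)"
    by (rule Bochner_Integration.integrable_bound[OF intD]) (use le in \<open>auto intro!: order_trans[OF _ abs_ge_self]\<close>)
  have "expectation (\<lambda>\<omega>. (((X \<omega>)\<^sup>2 - \<sigma>\<^sup>2) / g\<^sup>2 + b * X \<omega> / g)\<^sup>2) \<le> expectation D"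
    by (intro integral_mono int2 intD le)
  also have "expectation D = 4 * \<sigma> ^ 4 / g ^ 4 + 2 * b\<^sup>2 * \<sigma>\<^sup>2 / g\<^sup>2"
    unfolding D_def[abs_def] using int[of 2] int[of 4]
    by (simp add: expectation_normal_sq[OF \<sigma> X] expectation_normal_4[OF \<sigma> X] prob_space)
  also have "\<dots> \<le> 4 * \<sigma> ^ 4 / g ^ 4 + 2 * B\<^sup>2 * \<sigma>\<^sup>2 / g ^ 4"
  proof (intro add_left_mono frac_le mult_right_mono mult_left_mono)
    show "b\<^sup>2 \<le> B\<^sup>2" using b by (simp add: abs_le_square_iff[symmetric])
    show "g ^ 4 \<le> g\<^sup>2" using g by (intro power_decreasing) auto
  qed (use g in auto)
  also have "\<dots> = (4 * \<sigma> ^ 4 + 2 * B\<^sup>2 * \<sigma>\<^sup>2) * (1 / g ^ 4)" by (simp add: add_divide_distrib distrib_right)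
  finally show "expectation (\<lambda>\<omega>. (((X \<omega>)\<^sup>2 - \<sigma>\<^sup>2) / g\<^sup>2 + b * X \<omega> / g)\<^sup>2)
    \<le> (4 * \<sigma> ^ 4 + 2 * B\<^sup>2 * \<sigma>\<^sup>2) * (1 / g ^ 4)" .
qed

text \<open>The coefficients \<open>b\<close> are arbitrary because the bound is needed both for the
  signal coefficients and for \<open>b = 0\<close>, where only the centred squares remain.\<close>

lemma (in prob_space) noise_maximal_inequality:
  fixes X :: "nat \<Rightarrow> 'a \<Rightarrow> real"
  assumes \<sigma>: "0 < \<sigma>" and ind: "indep_vars (\<lambda>_. borel) X {..<n}"
    and X: "\<And>i. i < n \<Longrightarrow> distributed M lborel (X i) (\<lambda>t. ennreal (normal_density 0 \<sigma> t))"
    and g: "\<And>i. i < n \<Longrightarrow> 0 < g i" "\<And>i. i < n \<Longrightarrow> g i \<le> 1" and b: "\<And>i. i < n \<Longrightarrow> \<bar>b i\<bar> \<le> B" and a: "0 < a"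
  shows "prob {\<omega>\<in>space M. \<exists>k\<le>n. a \<le> \<bar>\<Sum>i<k. ((X i \<omega>)\<^sup>2 - \<sigma>\<^sup>2) / (g i)\<^sup>2 + b i * X i \<omega> / g i\<bar>}
    \<le> (4 * \<sigma> ^ 4 + 2 * B\<^sup>2 * \<sigma>\<^sup>2) * (\<Sum>i<n. 1 / g i ^ 4) / a\<^sup>2"
proof -
  let ?W = "\<lambda>i \<omega>. ((X i \<omega>)\<^sup>2 - \<sigma>\<^sup>2) / (g i)\<^sup>2 + b i * X i \<omega> / g i"
  have "indep_vars (\<lambda>_. borel) ?W {..<n}"
    by (rule indep_vars_compose2[OF ind, where Y = "\<lambda>i x. (x\<^sup>2 - \<sigma>\<^sup>2) / (g i)\<^sup>2 + b i * x / g i"]) simp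
  then have "prob {\<omega>\<in>space M. \<exists>k\<le>n. a \<le> \<bar>\<Sum>i<k. ?W i \<omega>\<bar>} \<le> (\<Sum>i<n. expectation (\<lambda>\<omega>. (?W i \<omega>)\<^sup>2)) / a\<^sup>2"
    by (rule Kolmogorov_maximal_inequality)
       (use \<sigma> X g b a integrable_noise_term_sq expectation_noise_term in blast)+
  also have "\<dots> \<le> (\<Sum>i<n. (4 * \<sigma> ^ 4 + 2 * B\<^sup>2 * \<sigma>\<^sup>2) * (1 / g i ^ 4)) / a\<^sup>2"
    using \<sigma> X g b by (intro divide_right_mono sum_mono expectation_noise_term_sq) auto
  finally show ?thesis by (simp add: sum_distrib_left)
qed

text \<open>The conclusion is free of \<alpha>, so the same two maximal events cover the whole
  supremum. The weighted sum is at most \<open>2 * (K / 8)\<close>, doubled \<open>K / 2\<close>,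
  and the unweighted sum adds another \<open>K / 2\<close>. The summand \<open>0 * E i / g i\<close>
  matches the form of \<open>noise_maximal_inequality\<close> with zero coefficients.\<close>

lemma sup_deviation_cases:
  fixes E x g :: "nat \<Rightarrow> real"
  assumes gpos: "\<And>i. i < n \<Longrightarrow> 0 < g i" and gdec: "\<And>i j. i \<le> j \<Longrightarrow> j < n \<Longrightarrow> g j \<le> g i"
    and \<alpha>: "0 \<le> \<alpha>" and c: "0 < c" and K: "0 \<le> K"
    and big: "c * K < \<bar>c * (2 * (\<Sum>i<n. \<alpha> / ((g i)\<^sup>2 + \<alpha>) * (((E i)\<^sup>2 - s) / (g i)\<^sup>2 + x i * E i / g i))
         - (\<Sum>i<n. ((E i)\<^sup>2 - s) / (g i)\<^sup>2))\<bar>"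
  shows "(\<exists>k\<le>n. K / 8 \<le> \<bar>\<Sum>i<k. ((E i)\<^sup>2 - s) / (g i)\<^sup>2 + x i * E i / g i\<bar>) \<or>
    (\<exists>k\<le>n. K / 2 \<le> \<bar>\<Sum>i<k. ((E i)\<^sup>2 - s) / (g i)\<^sup>2 + 0 * E i / g i\<bar>)"
proof (rule ccontr)
  let ?w = "\<lambda>i. ((E i)\<^sup>2 - s) / (g i)\<^sup>2 + x i * E i / g i"
  assume neg: "\<not> ?thesis"
  have 1: "\<bar>\<Sum>i<k. ?w i\<bar> \<le> K / 8" if "k \<le> n" for k
    using neg that by (meson linear)
  have 2: "\<bar>\<Sum>i<k. ((E i)\<^sup>2 - s) / (g i)\<^sup>2\<bar> \<le> K / 2" if "k \<le> n" for k
  proof -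
    have "\<bar>\<Sum>i<k. ((E i)\<^sup>2 - s) / (g i)\<^sup>2 + 0 * E i / g i\<bar> \<le> K / 2"
      using neg that by (meson linear)
    then show ?thesis by simp
  qed
  have "\<bar>\<Sum>i<n. \<alpha> / ((g i)\<^sup>2 + \<alpha>) * ?w i\<bar> \<le> 2 * (K / 8)"
  proof (rule abs_weighted_sum_le)
    fix i j assume ij: "i \<le> j" "j < n"
    have "(g j)\<^sup>2 \<le> (g i)\<^sup>2" using gdec[OF ij] gpos[OF ij(2)] by (intro power_mono) auto
    moreover have "0 < (g j)\<^sup>2" using gpos[OF ij(2)] by simp
    ultimately show "\<alpha> / ((g i)\<^sup>2 + \<alpha>) \<le> \<alpha> / ((g j)\<^sup>2 + \<alpha>)"
      using \<alpha> by (intro divide_left_mono) (auto intro!: mult_pos_pos add_pos_nonneg)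
  next
    fix i assume "i < n"
    then have "0 < (g i)\<^sup>2 + \<alpha>" using gpos[of i] \<alpha> by (simp add: add_pos_nonneg)
    then show "0 \<le> \<alpha> / ((g i)\<^sup>2 + \<alpha>)" "\<alpha> / ((g i)\<^sup>2 + \<alpha>) \<le> 1" using \<alpha> by simp_all
  qed (use 1 in auto)
  then have "\<bar>2 * (\<Sum>i<n. \<alpha> / ((g i)\<^sup>2 + \<alpha>) * ?w i) - (\<Sum>i<n. ((E i)\<^sup>2 - s) / (g i)\<^sup>2)\<bar> \<le> K"
    using 2[of n] by linarith
  then have "c * \<bar>2 * (\<Sum>i<n. \<alpha> / ((g i)\<^sup>2 + \<alpha>) * ?w i) - (\<Sum>i<n. ((E i)\<^sup>2 - s) / (g i)\<^sup>2)\<bar> \<le> c * K"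
    using c by (intro mult_left_mono) auto
  then show False using big c by (simp add: abs_mult)
qed

text \<open>The estimate for a fixed dimension: relative to its scale, the tail of the deviation is
  controlled by \<sigma>, \<open>B\<close> and \<open>T\<close> alone, hence uniformly in the
  dimension.\<close>

lemma (in prob_space)
  fixes e y :: "'a \<Rightarrow> real vec"
  assumes \<sigma>: "0 < \<sigma>" and n: "1 \<le> n" and e: "gaussian_noise M n \<sigma> e" and x: "x \<in> carrier_vec n"
    and y: "\<And>\<omega>. \<omega> \<in> space M \<Longrightarrow> y \<omega> = A *\<^sub>v x + e \<omega>"
    and sys: "singular_system n A U g V"
    and g0: "g 0 = 1" and gdec: "\<And>i j. i \<le> j \<Longrightarrow> j < n \<Longrightarrow> g j \<le> g i" and gpos: "\<And>i. i < n \<Longrightarrow> 0 < g i"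
    and B: "\<And>i. i < n \<Longrightarrow> \<bar>col V i \<bullet> x\<bar> \<le> B" and c: "0 < c"
  defines "Z \<equiv> \<lambda>\<omega>. SUP \<alpha>\<in>{0..}. ereal \<bar>c * SURE A \<sigma> \<alpha> (y \<omega>) - proj_loss c A x \<alpha> (y \<omega>)\<bar>"
  shows measurable_sup_deviation: "Z \<in> borel_measurable M"
    and prob_sup_deviation: "0 < T \<Longrightarrow>
      prob {\<omega>\<in>space M. \<bar>Z \<omega>\<bar> > ereal (T * (c * sqrt (\<Sum>i<n. 1 / g i ^ 4)))}
        \<le> 68 * (4 * \<sigma> ^ 4 + 2 * B\<^sup>2 * \<sigma>\<^sup>2) / T\<^sup>2"
proof -
  interpret singular_decomposition n A U V g
    using sys gpos by unfold_locales
  define X where "X i \<omega> = (\<Sum>j<n. U $$ (j, i) * e \<omega> $ j)" for i \<omega>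
  have U: "orthonormal_mat n U" and Uc: "U \<in> carrier_mat n n"
    using sys by (auto simp: singular_system_def orthonormal_mat_def)
  have ec: "e \<omega> \<in> carrier_vec n" if "\<omega> \<in> space M" for \<omega> using e that by (auto simp: gaussian_noise_def)
  have ind: "indep_vars (\<lambda>_. borel) X {..<n}"
    unfolding X_def[abs_def] by (rule indep_vars_rotated_noise[OF \<sigma> e U])
  have X: "distributed M lborel (X i) (\<lambda>t. ennreal (normal_density 0 \<sigma> t))" if "i < n" for i
    unfolding X_def[abs_def] by (rule distributed_rotated_noise[OF \<sigma> e U that])
  have Xm: "X i \<in> borel_measurable M" if "i < n" for i using X[OF that] by (simp add: distributed_def)
  have coord: "col U i \<bullet> e \<omega> = X i \<omega>" if "\<omega> \<in> space M" "i < n" for i \<omega>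
    using ec[OF that(1)] that(2) Uc by (auto simp: X_def scalar_prod_def lessThan_atLeast0)
  have g1: "g i \<le> 1" if "i < n" for i using gdec[of 0 i] g0 that by simp
  define b where "b i = col V i \<bullet> x" for i
  define F where "F \<alpha> \<omega> = \<bar>c * (2 * (\<Sum>i<n. \<alpha> / ((g i)\<^sup>2 + \<alpha>) * (((X i \<omega>)\<^sup>2 - \<sigma>\<^sup>2) / (g i)\<^sup>2 + b i * X i \<omega> / g i))
         - (\<Sum>i<n. ((X i \<omega>)\<^sup>2 - \<sigma>\<^sup>2) / (g i)\<^sup>2))\<bar>" for \<alpha> \<omega>
  have Z: "Z \<omega> = (SUP \<alpha>\<in>{0..}. ereal (F \<alpha> \<omega>))" if \<omega>: "\<omega> \<in> space M" for \<omega>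
    unfolding Z_def y[OF \<omega>] F_def b_def using coord[OF \<omega>]
    by (intro SUP_cong refl arg_cong[of _ _ ereal])
       (simp add: SURE_minus_proj_loss[OF _ x ec[OF \<omega>]])
  \<comment> \<open>Positive singular values keep the denominators nonzero, so \<open>F\<close> is
    continuous in \<alpha> and rational parameters suffice.\<close>
  have Zq: "Z \<omega> = (SUP \<alpha>\<in>{0..} \<inter> \<rat>. ereal (F \<alpha> \<omega>))" if \<omega>: "\<omega> \<in> space M" for \<omega>
    unfolding Z[OF \<omega>]
  proof (rule SUP_nonneg_reals_eq_Rats)
    have "(g i)\<^sup>2 + \<alpha> \<noteq> 0" if "i < n" "0 \<le> \<alpha>" for i \<alpha>
      using gpos[OF that(1)] that(2) by (smt (verit) zero_less_power)
    then show "continuous_on {0..} (\<lambda>\<alpha>. F \<alpha> \<omega>)"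
      unfolding F_def by (intro continuous_intros) auto
  qed
  have "(\<lambda>\<omega>. SUP \<alpha>\<in>{0..} \<inter> \<rat>. ereal (F \<alpha> \<omega>)) \<in> borel_measurable M"
  proof (rule borel_measurable_SUP)
    show "countable ({0..} \<inter> \<rat> :: real set)" using countable_rat by auto
    fix \<alpha>
    have "F \<alpha> \<in> borel_measurable M"
      unfolding F_def[abs_def]
      by (intro borel_measurable_abs borel_measurable_times borel_measurable_diff borel_measurable_sum
         borel_measurable_add borel_measurable_divide borel_measurable_power borel_measurable_const) (use Xm in auto)
    then show "(\<lambda>\<omega>. ereal (F \<alpha> \<omega>)) \<in> borel_measurable M" by measurable
  qed
  then show "Z \<in> borel_measurable M"
    using Zq by (simp cong: measurable_cong)
  assume T: "0 < T"
  define D where "D = sqrt (\<Sum>i<n. 1 / g i ^ 4)"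
  have "0 < (\<Sum>i<n. 1 / g i ^ 4)"
    using n by (intro sum_pos) (auto simp: lessThan_empty_iff dest: gpos)
  then have D: "0 < D" and D2: "(\<Sum>i<n. 1 / g i ^ 4) = D\<^sup>2" by (auto simp: D_def)
  have B0: "0 \<le> B" using B[of 0] n by simp
  define E where "E a b = {\<omega>\<in>space M. \<exists>k\<le>n. a \<le> \<bar>\<Sum>i<k. ((X i \<omega>)\<^sup>2 - \<sigma>\<^sup>2) / (g i)\<^sup>2 + b i * X i \<omega> / g i\<bar>}" for a b
  have E: "E a b \<in> sets M" for a b
  proof -
    have "(\<lambda>\<omega>. \<Sum>i<k. ((X i \<omega>)\<^sup>2 - \<sigma>\<^sup>2) / (g i)\<^sup>2 + b i * X i \<omega> / g i) \<in> borel_measurable M" if "k \<le> n" for k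
      using Xm that by (intro borel_measurable_sum borel_measurable_add borel_measurable_divide
        borel_measurable_times borel_measurable_diff borel_measurable_power borel_measurable_const) auto
    then have "(\<Union>k\<le>n. {\<omega>\<in>space M. a \<le> \<bar>\<Sum>i<k. ((X i \<omega>)\<^sup>2 - \<sigma>\<^sup>2) / (g i)\<^sup>2 + b i * X i \<omega> / g i\<bar>}) \<in> sets M"
      by (intro sets.finite_UN) auto
    also have "(\<Union>k\<le>n. {\<omega>\<in>space M. a \<le> \<bar>\<Sum>i<k. ((X i \<omega>)\<^sup>2 - \<sigma>\<^sup>2) / (g i)\<^sup>2 + b i * X i \<omega> / g i\<bar>}) = E a b"
      by (auto simp: E_def)
    finally show ?thesis .
  qed
  have "{\<omega>\<in>space M. \<bar>Z \<omega>\<bar> > ereal (T * (c * D))} \<subseteq> E (T * D / 8) b \<union> E (T * D / 2) (\<lambda>_. 0)"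
  proof
    fix \<omega> assume "\<omega> \<in> {\<omega>\<in>space M. \<bar>Z \<omega>\<bar> > ereal (T * (c * D))}"
    then have \<omega>: "\<omega> \<in> space M" and big: "ereal (c * (T * D)) < \<bar>Z \<omega>\<bar>" by (auto simp: mult_ac)
    \<comment> \<open>A single parameter, here 0, shows that the supremum of absolute values is
      nonnegative; the outer absolute value drops and some \<alpha> must exceed the
      threshold.\<close>
    have "0 \<le> Z \<omega>" unfolding Z[OF \<omega>] by (rule SUP_upper2[of 0]) (auto simp: F_def)
    with big obtain \<alpha> where "0 \<le> \<alpha>" "c * (T * D) < F \<alpha> \<omega>"
      by (auto simp: Z[OF \<omega>] less_SUP_iff)
    from sup_deviation_cases[OF gpos gdec this(1) c _ this(2)[unfolded F_def]]
    show "\<omega> \<in> E (T * D / 8) b \<union> E (T * D / 2) (\<lambda>_. 0)"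
      using T D \<omega> unfolding E_def by auto
  qed
  then have "prob {\<omega>\<in>space M. \<bar>Z \<omega>\<bar> > ereal (T * (c * D))} \<le> prob (E (T * D / 8) b \<union> E (T * D / 2) (\<lambda>_. 0))"
    by (rule finite_measure_mono) (use E in auto)
  also have "\<dots> \<le> prob (E (T * D / 8) b) + prob (E (T * D / 2) (\<lambda>_. 0))"
    by (rule measure_Un_le) (rule E)+
  also have "\<dots> \<le> (4 * \<sigma> ^ 4 + 2 * B\<^sup>2 * \<sigma>\<^sup>2) * D\<^sup>2 / (T * D / 8)\<^sup>2 + (4 * \<sigma> ^ 4 + 2 * B\<^sup>2 * \<sigma>\<^sup>2) * D\<^sup>2 / (T * D / 2)\<^sup>2"
    unfolding E_def D2[symmetric] using T D B B0
    by (intro add_mono noise_maximal_inequality[OF \<sigma> ind X gpos g1]) (auto simp: b_def)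
  \<comment> \<open>The thresholds contribute \<open>8\<^sup>2 + 2\<^sup>2 = 68\<close>, and
    \<open>D\<^sup>2\<close> cancels.\<close>
  also have "\<dots> = 68 * (4 * \<sigma> ^ 4 + 2 * B\<^sup>2 * \<sigma>\<^sup>2) / T\<^sup>2"
    using T D by (simp add: field_simps power2_eq_square)
  finally show "prob {\<omega>\<in>space M. \<bar>Z \<omega>\<bar> > ereal (T * (c * sqrt (\<Sum>i<n. 1 / g i ^ 4)))}
        \<le> 68 * (4 * \<sigma> ^ 4 + 2 * B\<^sup>2 * \<sigma>\<^sup>2) / T\<^sup>2" unfolding D_def .
qed

text \<open>A tail bound with a constant \<open>C\<close> common to all \<open>m\<close> survives
  the upper limit in \<open>m\<close>, and \<open>C / T\<^sup>2\<close> vanishes as \<open>T\<close>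
  grows.\<close>

lemma bigO_P_I:
  assumes meas: "\<And>m. 1 \<le> m \<Longrightarrow> Z m \<in> borel_measurable (M m)" and pos: "\<And>m. 1 \<le> m \<Longrightarrow> 0 < r m"
    and tail: "\<And>m T. 1 \<le> m \<Longrightarrow> 0 < T \<Longrightarrow>
      measure (M m) {\<omega>\<in>space (M m). \<bar>Z m \<omega>\<bar> > ereal (T * r m)} \<le> C / T\<^sup>2"
  shows "bigO_P M Z r"
  unfolding bigO_P_def
proof (intro conjI allI impI)
  let ?p = "\<lambda>T m. measure (M m) {\<omega>\<in>space (M m). \<bar>Z m \<omega>\<bar> > ereal (T * r m)}"
  show "((\<lambda>T. limsup (\<lambda>m. ereal (?p T m))) \<longlongrightarrow> 0) at_top"
  proof (rule tendsto_sandwich)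
    show "\<forall>\<^sub>F T in at_top. 0 \<le> limsup (\<lambda>m. ereal (?p T m))"
      by (intro always_eventually allI le_Limsup) auto
    show "\<forall>\<^sub>F T in at_top. limsup (\<lambda>m. ereal (?p T m)) \<le> ereal (C / T\<^sup>2)"
      using eventually_gt_at_top[of 0]
    proof eventually_elim
      case (elim T)
      show ?case
        by (rule Limsup_bounded) (use eventually_ge_at_top[of 1] in eventually_elim, use elim tail in auto)
    qed
    show "((\<lambda>T. ereal (C / T\<^sup>2)) \<longlongrightarrow> 0) at_top"
      unfolding zero_ereal_def
      by (intro tendsto_ereal tendsto_divide_0[OF tendsto_const] filterlim_at_top_imp_at_infinity
          filterlim_pow_at_top filterlim_ident) simp
  qed simp
qed (use meas pos in auto)

theorem theorem5:
  fixes M :: "nat \<Rightarrow> 'w measure"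
    and A U V :: "nat \<Rightarrow> real mat"
    and \<gamma> :: "nat \<Rightarrow> nat \<Rightarrow> real"
    and xs :: "nat \<Rightarrow> real vec"
    and \<epsilon> y :: "nat \<Rightarrow> 'w \<Rightarrow> real vec"
    and \<sigma> :: real
    and c d :: "nat \<Rightarrow> real"
  assumes "\<sigma> > 0"
    and "\<And>m. m \<ge> 1 \<Longrightarrow> prob_space (M m)"
    and "\<And>m. m \<ge> 1 \<Longrightarrow> A m \<in> carrier_mat m m"
    and "\<And>m. m \<ge> 1 \<Longrightarrow> vec_space.rank m (A m) = m"
    and "\<And>m. m \<ge> 1 \<Longrightarrow> gaussian_noise (M m) m \<sigma> (\<epsilon> m)"
    and "\<And>m. m \<ge> 1 \<Longrightarrow> xs m \<in> carrier_vec m"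
    and "\<And>m \<omega>. m \<ge> 1 \<Longrightarrow> \<omega> \<in> space (M m) \<Longrightarrow> y m \<omega> = A m *\<^sub>v xs m + \<epsilon> m \<omega>"
    and "\<And>m. m \<ge> 1 \<Longrightarrow> singular_system m (A m) (U m) (\<gamma> m) (V m)"
    and "\<And>m. m \<ge> 1 \<Longrightarrow> \<gamma> m 0 = 1"
    and "\<And>m i j. i \<le> j \<Longrightarrow> j < m \<Longrightarrow> \<gamma> m j \<le> \<gamma> m i"
    and "\<And>m i. i < m \<Longrightarrow> \<gamma> m i > 0"
    and "\<And>m. m \<ge> 1 \<Longrightarrow> c m = inverse (\<Sum>i<m. 1 / (\<gamma> m i)\<^sup>2)"
    and "\<And>m. m \<ge> 1 \<Longrightarrow> d m = c m * sqrt (\<Sum>i<m. 1 / (\<gamma> m i) ^ 4)"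
    and "\<exists>B. \<forall>m\<ge>1. \<forall>i<m. \<bar>col (V m) i \<bullet> xs m\<bar> \<le> B"
  shows "bigO_P M
    (\<lambda>m \<omega>. SUP \<alpha>\<in>{0..}. ereal \<bar>c m * SURE (A m) \<sigma> \<alpha> (y m \<omega>)
                               - proj_loss (c m) (A m) (xs m) \<alpha> (y m \<omega>)\<bar>) d"
proof -
  obtain B where B: "\<And>m i. 1 \<le> m \<Longrightarrow> i < m \<Longrightarrow> \<bar>col (V m) i \<bullet> xs m\<bar> \<le> B"
    using assms(14) by blast
  \<comment> \<open>The exponent is left open: 2 serves \<open>c m\<close> and 4 serves
    \<open>d m\<close>.\<close>
  have sum_pos: "0 < (\<Sum>i<m. 1 / (\<gamma> m i) ^ k)" if "1 \<le> m" for m k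
    using that assms(11) by (intro sum_pos) (auto simp: lessThan_empty_iff)
  have c: "0 < c m" if "1 \<le> m" for m
    using sum_pos[OF that, of 2] assms(12)[OF that] by simp
  show ?thesis
  proof (rule bigO_P_I)
    fix m :: nat assume m: "1 \<le> m"
    interpret prob_space "M m" using assms(2)[OF m] .
    note facts = assms(1) m assms(5)[OF m] assms(6)[OF m] assms(7)[OF m] assms(8)[OF m] assms(9)[OF m]
      assms(10)[of _ _ m] assms(11)[of _ m] B[OF m] c[OF m]
    show "0 < d m" using c[OF m] sum_pos[OF m] assms(13)[OF m] by simp
    show "(\<lambda>\<omega>. SUP \<alpha>\<in>{0..}. ereal \<bar>c m * SURE (A m) \<sigma> \<alpha> (y m \<omega>)
        - proj_loss (c m) (A m) (xs m) \<alpha> (y m \<omega>)\<bar>) \<in> borel_measurable (M m)"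
      by (rule measurable_sup_deviation[OF facts])
    show "prob {\<omega>\<in>space (M m). \<bar>SUP \<alpha>\<in>{0..}. ereal \<bar>c m * SURE (A m) \<sigma> \<alpha> (y m \<omega>)
        - proj_loss (c m) (A m) (xs m) \<alpha> (y m \<omega>)\<bar>\<bar> > ereal (T * d m)}
        \<le> 68 * (4 * \<sigma> ^ 4 + 2 * B\<^sup>2 * \<sigma>\<^sup>2) / T\<^sup>2" if "0 < T" for T
      unfolding assms(13)[OF m] by (rule prob_sup_deviation[OF facts that])
  qed
qed

end
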